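(* Let $\lambda$ be a partition with $\ell(\lambda)=k$. Then, viewing $\mathrm{Sym}\subseteq \mathrm{QSym}$, \[ s_\lambda = \sum_{\sigma} (-1)^\sigma\, \mathfrak{S}^*_{(\lambda_{\sigma_1}+1-\sigma_1,\ \lambda_{\sigma_2}+2-\sigma_2,\ \dots,\ \lambda_{\sigma_k}+k-\sigma_k)}, \] where the sum is over permutations $\sigma\in S_k$ such that $\lambda_{\sigma_i}+i-\sigma_i>0$ for all $i\in\{1,\dots,k\}$.
   Context: $\mathrm{NSym}$ is the free associative algebra over $\mathbb{Q}$ on $H_1,H_2,\dots$ ($H_0=1$, $H_{-r}=0$ for $r>0$), graded dual to $\mathrm{QSym}$ through $\langle H_{\alpha_1}\cdots H_{\alpha_k},M_\beta\rangle=\delta_{\alpha\beta}$, $M_\beta$ the monomial quasisymmetric functions; coproduct $\Delta(H_j)=\sum_i H_i\otimes H_{j-i}$. For $F\in\mathrm{QSym}$, $F^\perp$ is given by $\langle F^\perp(H),G\rangle=\langle H,FG\rangle$, and $F_{1^i}=M_{1^i}$. Let $\mathbb{B}_m=\sum_{i\ge0}(-1)^iH_{m+i}F_{1^i}^\perp$ and $\mathfrak{S}_\alpha=\mathbb{B}_{\alpha_1}\cdots\mathbb{B}_{\alpha_m}(1)$; $\{\mathfrak{S}_\alpha:\alpha\models n\}$ is a basis of $\mathrm{NSym}_n$ and $\{\mathfrak{S}^*_\alpha\}$ denotes the dual basis of $\mathrm{QSym}$. $\mathrm{Sym}$ is the subalgebra of symmetric functions in $\mathrm{QSym}$ and $s_\lambda$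 is the Schur function. $(-1)^\sigma$ is the sign of $\sigma$. *)

theory Defs
  imports Complex_Main
    "HOL-Library.Poly_Mapping"
    "HOL-Library.Groups_Big_Fun"
    "HOL-Library.FuncSet"
    "HOL-Combinatorics.Permutations"
begin

section \<open>Compositions\<close>

text \<open>Compositions form the free monoid on the positive integers; the additive monoid structure
  below is concatenation, which is what the key type of a convolution algebra \<open>_ \<Rightarrow>\<^sub>0 _\<close> needs.\<close>

typedef composition = "{xs :: nat list. \<forall>x\<in>set xs. 0 < x}"
  morphisms parts Composition
  by (rule exI[of _ "[]"]) simp

lemma parts_pos: "x \<in> set (parts \<alpha>) \<Longrightarrow> 0 < x"
  using parts[of \<alpha>] by auto

lemma parts_Composition: "(\<And>x. x \<in> set xs \<Longrightarrow> 0 < x) \<Longrightarrow> parts (Composition xs) = xs"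
  by (rule Composition_inverse) simp

instantiation composition :: monoid_add
begin

definition zero_composition :: composition where
  "0 = Composition []"

definition plus_composition :: "composition \<Rightarrow> composition \<Rightarrow> composition" where
  "\<alpha> + \<beta> = Composition (parts \<alpha> @ parts \<beta>)"

lemma parts_zero [simp]: "parts 0 = []"
  by (auto simp: zero_composition_def intro!: parts_Composition)

lemma parts_plus [simp]: "parts (\<alpha> + \<beta>) = parts \<alpha> @ parts \<beta>"
  unfolding plus_composition_def by (rule parts_Composition) (auto dest: parts_pos)

instance
  by standard (simp_all add: parts_inject[symmetric])

end


section \<open>The algebra NSym\<close>

text \<open>The free associative algebra over the rationals on \<open>H\<^sub>1, H\<^sub>2, \<dots>\<close>, as the monoid algebra of the
  free monoid: the basis element of \<open>\<alpha>\<close> is the monomial \<open>H\<^bsub>\<alpha>\<^sub>1\<^esub> \<cdots> H\<^bsub>\<alpha>\<^sub>k\<^esub>\<close>.\<close>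

type_synonym nsym = "composition \<Rightarrow>\<^sub>0 rat"

definition H :: "int \<Rightarrow> nsym" where
  "H r = (if r < 0 then 0 else if r = 0 then 1
          else Poly_Mapping.single (Composition [nat r]) 1)"

lemma prod_list_H: "prod_list (map (\<lambda>a. H (int a)) (parts \<alpha>)) = Poly_Mapping.single \<alpha> 1"
proof -
  have "prod_list (map (\<lambda>a. H (int a)) xs) = Poly_Mapping.single (Composition xs) 1"
    if "\<forall>x\<in>set xs. 0 < x" for xs
    using that
  proof (induction xs)
    case Nil
    show ?case by (simp flip: zero_composition_def)
  next
    case (Cons x xs)
    have "parts (Composition [x]) = [x]" "parts (Composition xs) = xs"
      using Cons.prems by (auto intro!: parts_Composition)
    then have "Composition [x] + Composition xs = Composition (x # xs)"
      by (simp add: plus_composition_def)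
    with Cons show ?case by (simp add: H_def mult_single)
  qed
  from this[of "parts \<alpha>"] show ?thesis
    by (auto simp: parts_inverse dest: parts_pos)
qed


section \<open>Quasisymmetric functions\<close>

text \<open>A formal power series over the rationals in the commuting variables \<open>x\<^sub>0, x\<^sub>1, \<dots>\<close>, given by
  the coefficients of its monomials; a monomial is an exponent vector of finite support.\<close>

type_synonym monomial = "nat \<Rightarrow>\<^sub>0 nat"
type_synonym series = "monomial \<Rightarrow> rat"

text \<open>The Cauchy product of power series.\<close>

definition series_mult :: "series \<Rightarrow> series \<Rightarrow> series" where
  "series_mult F G = (\<lambda>x. \<Sum>(y, z) | y + z = x. F y * G z)"

definition mdeg :: "monomial \<Rightarrow> nat" where
  "mdeg x = (\<Sum>v\<in>Poly_Mapping.keys x. Poly_Mapping.lookup x v)"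

text \<open>The monomial \<open>x\<^bsub>is ! 0\<^esub>\<close> to the power \<open>es ! 0\<close>, times \<open>x\<^bsub>is ! 1\<^esub>\<close> to the power \<open>es ! 1\<close>, etc.\<close>

definition monom_of :: "nat list \<Rightarrow> nat list \<Rightarrow> monomial" where
  "monom_of is es = (\<Sum>j<length es. Poly_Mapping.single (is ! j) (es ! j))"

definition QSym :: "series set" where
  "QSym = {F. (\<exists>d. \<forall>x. F x \<noteq> 0 \<longrightarrow> mdeg x \<le> d) \<and>
     (\<forall>\<beta> is js. sorted_wrt (<) is \<and> sorted_wrt (<) js \<and>
        length is = length (parts \<beta>) \<and> length js = length (parts \<beta>) \<longrightarrow>
        F (monom_of is (parts \<beta>)) = F (monom_of js (parts \<beta>)))}"

definition M :: "composition \<Rightarrow> series" where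
  "M \<beta> = (\<lambda>x. if \<exists>is. sorted_wrt (<) is \<and> length is = length (parts \<beta>) \<and>
                    x = monom_of is (parts \<beta>) then 1 else 0)"

text \<open>\<open>F\<^bsub>1^i\<^esub> = M\<^bsub>1^i\<^esub>\<close>\<close>

definition F1 :: "nat \<Rightarrow> series" where
  "F1 i = M (Composition (replicate i 1))"


section \<open>Duality\<close>

text \<open>\<open>M\<^sub>\<beta>\<close> is the only monomial quasisymmetric function in which
  the monomial with exponents \<open>\<beta>\<^sub>1, \<dots>, \<beta>\<^sub>k\<close> on \<open>x\<^sub>0, \<dots>, x\<^bsub>k-1\<^esub>\<close> occurs, so the coefficient of that
  monomial in \<open>F \<in> QSym\<close> is the coordinate of \<open>F\<close> at \<open>M\<^sub>\<beta>\<close>.\<close>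

definition M_coeff :: "composition \<Rightarrow> series \<Rightarrow> rat" where
  "M_coeff \<beta> F = F (monom_of [0..<length (parts \<beta>)] (parts \<beta>))"

definition pairing :: "nsym \<Rightarrow> series \<Rightarrow> rat" where
  "pairing h F = (\<Sum>\<alpha>\<in>Poly_Mapping.keys h. Poly_Mapping.lookup h \<alpha> * M_coeff \<alpha> F)"

text \<open>The pairing satisfies \<open>\<langle>H\<^bsub>\<alpha>\<^sub>1\<^esub> \<cdots> H\<^bsub>\<alpha>\<^sub>k\<^esub>, M\<^sub>\<beta>\<rangle> = \<delta>\<^bsub>\<alpha>\<beta>\<^esub>\<close>.\<close>

lemma lookup_monom_of:
  assumes "sorted_wrt (<) is" "length is = length es" "j < length es"
  shows "Poly_Mapping.lookup (monom_of is es) (is ! j) = es ! j"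
proof -
  have "is ! i = is ! j \<longleftrightarrow> i = j" if "i < length es" for i
    using assms that by (simp add: nth_eq_iff_index_eq strict_sorted_iff)
  then have "(\<Sum>i<length es. Poly_Mapping.lookup (Poly_Mapping.single (is ! i) (es ! i)) (is ! j)) =
      (\<Sum>i<length es. if i = j then es ! i else 0)"
    by (intro sum.cong) (auto simp: lookup_single when_def)
  then show ?thesis
    using assms(3) by (simp add: monom_of_def lookup_sum)
qed

lemma keys_monom_of:
  assumes "sorted_wrt (<) is" "length is = length es" "\<forall>e\<in>set es. 0 < e"
  shows "Poly_Mapping.keys (monom_of is es) = set is"
proof
  have "Poly_Mapping.keys (monom_of is es) \<subseteq>
      (\<Union>j<length es. Poly_Mapping.keys (Poly_Mapping.single (is ! j) (es ! j)))"
    unfolding monom_of_def by (rule keys_sum)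
  also have "\<dots> \<subseteq> set is"
    using assms(2) by (auto split: if_splits)
  finally show "Poly_Mapping.keys (monom_of is es) \<subseteq> set is" .
  show "set is \<subseteq> Poly_Mapping.keys (monom_of is es)"
    using assms lookup_monom_of[OF assms(1,2)]
    by (force simp: in_set_conv_nth in_keys_iff)
qed

lemma monom_of_inject:
  assumes "sorted_wrt (<) is" "length is = length (parts \<beta>)"
    and "sorted_wrt (<) js" "length js = length (parts \<gamma>)"
    and "monom_of is (parts \<beta>) = monom_of js (parts \<gamma>)"
  shows "is = js" and "\<beta> = \<gamma>"
proof -
  have "set is = set js"
    using keys_monom_of[OF assms(1,2)] keys_monom_of[OF assms(3,4)] assms(5)
    by (simp add: parts_pos)
  then show "is = js"
    using assms(1,3) strict_sorted_equal by blast
  then have "parts \<beta> = parts \<gamma>"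
    using assms lookup_monom_of[OF assms(1,2)] lookup_monom_of[OF assms(3,4)]
    by (intro nth_equalityI) auto
  then show "\<beta> = \<gamma>"
    by (simp add: parts_inject)
qed

lemma pairing_H_M:
  "pairing (prod_list (map (\<lambda>a. H (int a)) (parts \<alpha>))) (M \<beta>) = (if \<alpha> = \<beta> then 1 else 0)"
proof -
  have "(\<exists>is. sorted_wrt (<) is \<and> length is = length (parts \<beta>) \<and>
      monom_of [0..<length (parts \<alpha>)] (parts \<alpha>) = monom_of is (parts \<beta>)) \<longleftrightarrow> \<alpha> = \<beta>"
    (is "?L \<longleftrightarrow> ?R")
  proof
    assume ?L
    then show ?R
      using monom_of_inject(2)[of "[0..<length (parts \<alpha>)]" \<alpha> _ \<beta>] by auto
  next
    assume ?R
    then show ?L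
      by (intro exI[of _ "[0..<length (parts \<beta>)]"]) simp
  qed
  then have "M_coeff \<alpha> (M \<beta>) = (if \<alpha> = \<beta> then 1 else 0)"
    by (simp add: M_coeff_def M_def)
  then show ?thesis
    by (simp add: prod_list_H pairing_def)
qed

definition perp :: "series \<Rightarrow> nsym \<Rightarrow> nsym" where
  "perp F h = (THE k. \<forall>G\<in>QSym. pairing k G = pairing h (series_mult F G))"


section \<open>Immaculate functions and their duals\<close>

text \<open>\<open>Sum_any\<close> sums over the indices of the nonzero terms; there are finitely many of them, since
  \<open>F\<^bsub>1^i\<^esub>\<^sup>\<bottom>\<close> lowers the degree by \<open>i\<close>.\<close>

definition B :: "int \<Rightarrow> nsym \<Rightarrow> nsym" where
  "B m h = Sum_any (\<lambda>i::nat. (- 1) ^ i * H (m + int i) * perp (F1 i) h)"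

definition immaculate :: "composition \<Rightarrow> nsym" where
  "immaculate \<alpha> = foldr (\<lambda>m. B (int m)) (parts \<alpha>) 1"

definition dual_immaculate :: "composition \<Rightarrow> series" where
  "dual_immaculate \<alpha> =
     (THE F. F \<in> QSym \<and> (\<forall>\<beta>. pairing (immaculate \<beta>) F = (if \<alpha> = \<beta> then 1 else 0)))"


section \<open>Schur functions\<close>

definition is_partition :: "nat list \<Rightarrow> bool" where
  "is_partition la \<longleftrightarrow> sorted_wrt (\<ge>) la \<and> (\<forall>p\<in>set la. 0 < p)"

definition cells :: "nat list \<Rightarrow> (nat \<times> nat) set" where
  "cells la = {(i, j). i < length la \<and> j < la ! i}"

text \<open>Semistandard Young tableaux of shape \<open>la\<close>. The entries are indices of variables, so they
  start from 0.\<close>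

definition ssyt :: "nat list \<Rightarrow> (nat \<times> nat \<Rightarrow> nat) set" where
  "ssyt la = {T \<in> cells la \<rightarrow>\<^sub>E UNIV.
     (\<forall>i j j'. (i, j) \<in> cells la \<and> (i, j') \<in> cells la \<and> j < j' \<longrightarrow> T (i, j) \<le> T (i, j')) \<and>
     (\<forall>i i' j. (i, j) \<in> cells la \<and> (i', j) \<in> cells la \<and> i < i' \<longrightarrow> T (i, j) < T (i', j))}"

definition content :: "nat list \<Rightarrow> (nat \<times> nat \<Rightarrow> nat) \<Rightarrow> monomial" where
  "content la T = (\<Sum>c\<in>cells la. Poly_Mapping.single (T c) 1)"

definition schur :: "nat list \<Rightarrow> series" where
  "schur la = (\<lambda>x. of_nat (card {T \<in> ssyt la. content la T = x}))"

end

theory Submission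
  imports Defs "Jordan_Normal_Form.Determinant"
begin

text \<open>The dual immaculate functions are a basis, so it suffices to compute
  \<open>\<langle>\<SS>\<^sub>\<beta>, s\<^sub>\<lambda>\<rangle>\<close> for all \<open>\<beta>\<close>. Let the Laurent monomial \<open>x\<^sup>\<gamma>\<close> stand for the word
  \<open>H\<^bsub>\<gamma>\<^sub>1\<^esub> \<cdots> H\<^bsub>\<gamma>\<^sub>m\<^esub>\<close>. Since \<open>F\<^bsub>1^i\<^esub>\<^sup>\<bottom>\<close> lowers \<open>i\<close> letters of a word by one in all possible
  ways, applying \<open>B\<^sub>b\<close> means multiplying by \<open>y\<^sup>b \<Prod>\<^sub>j (1 - y / x\<^sub>j)\<close> for a new leading variable
  \<open>y\<close>, so that \<open>\<SS>\<^sub>\<beta>\<close> corresponds to \<open>x\<^sup>\<beta> \<Prod>\<^bsub>i<j\<^esub> (1 - x\<^sub>i / x\<^sub>j)\<close>, a Vandermonde product up to a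
  monomial. As \<open>\<langle>H\<^sub>\<gamma>, s\<^sub>\<lambda>\<rangle>\<close> is the coefficient of \<open>x\<^sup>\<gamma>\<close> in \<open>s\<^sub>\<lambda>(x\<^sub>1, \<dots>, x\<^sub>m)\<close>, the pairing
  \<open>\<langle>\<SS>\<^sub>\<beta>, s\<^sub>\<lambda>\<rangle>\<close> is the coefficient of \<open>x\<^bsup>\<beta>+\<delta>\<^esup>\<close> in the product of the Vandermonde determinant and
  \<open>s\<^sub>\<lambda>\<close>. By the bialternant formula this product is the alternant \<open>a\<^bsub>\<lambda>+\<delta>\<^esub>\<close>, whose expansion is the
  signed sum over permutations.\<close>

section \<open>Semistandard tableaux\<close>

definition ssyt_below :: "nat \<Rightarrow> nat list \<Rightarrow> (nat \<times> nat \<Rightarrow> nat) set" where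
  "ssyt_below n la = {T \<in> ssyt la. \<forall>c\<in>cells la. T c < n}"

text \<open>The Schur polynomial in \<open>n\<close> variables. The ring is left arbitrary, so that
  inverted Laurent variables can be substituted.\<close>

definition schur_poly :: "nat \<Rightarrow> (nat \<Rightarrow> 'a::comm_ring_1) \<Rightarrow> nat list \<Rightarrow> 'a" where
  "schur_poly n x la = (\<Sum>T\<in>ssyt_below n la. \<Prod>c\<in>cells la. x (T c))"

lemma cells_Sigma: "cells la = Sigma {..<length la} (\<lambda>i. {..<la ! i})"
  by (auto simp: cells_def)

lemma finite_cells [simp]: "finite (cells la)"
  by (simp add: cells_Sigma)

lemma finite_ssyt_below [simp]: "finite (ssyt_below n la)"
proof (rule finite_subset)
  show "ssyt_below n la \<subseteq> Pi\<^sub>E (cells la) (\<lambda>_. {..<n})"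
    by (auto simp: ssyt_below_def ssyt_def PiE_def Pi_def)
qed (simp add: finite_PiE)

lemma ssytD:
  assumes "T \<in> ssyt la"
  shows "T \<in> extensional (cells la)"
    and "\<And>i j j'. (i, j) \<in> cells la \<Longrightarrow> (i, j') \<in> cells la \<Longrightarrow> j < j' \<Longrightarrow> T (i, j) \<le> T (i, j')"
    and "\<And>i i' j. (i, j) \<in> cells la \<Longrightarrow> (i', j) \<in> cells la \<Longrightarrow> i < i' \<Longrightarrow> T (i, j) < T (i', j)"
  using assms by (auto simp: ssyt_def PiE_def)

text \<open>In a partition shape the cell above a cell is again a cell, so column strictness raises
  the entry by at least one per row, starting from 0.\<close>

lemma ssyt_entry_ge_row:
  assumes T: "T \<in> ssyt la" and dec: "sorted_wrt (\<ge>) la" and c: "(i, j) \<in> cells la"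
  shows "i \<le> T (i, j)"
  using c
proof (induction i)
  case (Suc i)
  have "la ! Suc i \<le> la ! i"
    using Suc.prems sorted_wrt_nth_less[OF dec, of i "Suc i"] by (simp add: cells_def)
  then have "(i, j) \<in> cells la"
    using Suc.prems by (simp add: cells_def)
  with Suc ssytD(3)[OF T this Suc.prems] show ?case by simp
qed simp

text \<open>The shape that remains when every entry \<open>n\<close> is removed from a tableau with
  entries at most \<open>n\<close>. Row \<open>n\<close> is left out because it contains no smaller
  entry; the restriction makes the shape an element of a \<open>Pi\<^sub>E\<close> set.\<close>

definition inner_shape :: "nat \<Rightarrow> nat list \<Rightarrow> (nat \<times> nat \<Rightarrow> nat) \<Rightarrow> nat \<Rightarrow> nat" where
  "inner_shape n la T = (\<lambda>i\<in>{..<n}. card {j. j < la ! i \<and> T (i, j) < n})"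

context
  fixes la :: "nat list" and n :: nat
  assumes len: "length la = Suc n" and dec: "sorted_wrt (\<ge>) la"
begin

text \<open>Rows increase weakly, so the entries below \<open>n\<close> fill an initial segment of
  each row, and an initial segment of the naturals is determined by its cardinality. In row
  \<open>n\<close> all entries are at least \<open>n\<close>.\<close>

lemma inner_cells_iff:
  assumes T: "T \<in> ssyt_below (Suc n) la" and c: "(i, j) \<in> cells la"
  shows "T (i, j) < n \<longleftrightarrow> i < n \<and> j < inner_shape n la T i"
proof (cases "i < n")
  case False
  then show ?thesis
    using T c ssyt_entry_ge_row[OF _ dec c, of T] by (simp add: ssyt_below_def)
next
  case True
  define S where "S = {j. j < la ! i \<and> T (i, j) < n}"
  have T': "T \<in> ssyt la" using T by (simp add: ssyt_below_def)
  have dcl: "j' \<in> S" if "j'' \<in> S" "j' \<le> j''" for j' j''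
  proof (cases "j' = j''")
    case False
    then have "T (i, j') \<le> T (i, j'')"
      using that True len by (intro ssytD(2)[OF T']) (auto simp: S_def cells_def)
    then show ?thesis using that by (auto simp: S_def)
  qed (use that in simp)
  have fin: "finite S" by (simp add: S_def)
  have "j \<in> S \<longleftrightarrow> j < card S"
  proof
    assume "j \<in> S"
    then have "{..j} \<subseteq> S" using dcl by auto
    from card_mono[OF fin this] show "j < card S" by simp
  next
    assume *: "j < card S"
    show "j \<in> S"
    proof (rule ccontr)
      assume "j \<notin> S"
      then have "S \<subseteq> {..<j}" using dcl by (meson lessThan_iff linorder_not_less subsetI)
      from card_mono[OF _ this] * show False by simp
    qed
  qed
  then show ?thesis
    using True c by (simp add: inner_shape_def S_def cells_def)
qed

text \<open>A cell of row \<open>i\<close> with a cell below it is smaller than an entry that is at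
  most \<open>n\<close>. Hence only the part of row \<open>i\<close> beyond row \<open>i + 1\<close>
  can carry \<open>n\<close>.\<close>

lemma inner_shape_interlaces:
  assumes T: "T \<in> ssyt_below (Suc n) la"
  shows "inner_shape n la T \<in> Pi\<^sub>E {..<n} (\<lambda>i. {la ! Suc i..la ! i})"
proof (rule PiE_I)
  fix i assume i: "i \<in> {..<n}"
  have le: "la ! Suc i \<le> la ! i"
    using i len sorted_wrt_nth_less[OF dec, of i "Suc i"] by simp
  have "T (i, j) < n" if "j < la ! Suc i" for j
  proof -
    have "T (i, j) < T (Suc i, j)" "T (Suc i, j) < Suc n"
      using T that i len le ssytD(3)[of T la i j "Suc i"] by (auto simp: ssyt_below_def cells_def)
    then show ?thesis by simp
  qed
  then have "{..<la ! Suc i} \<subseteq> {j. j < la ! i \<and> T (i, j) < n}" using le by auto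
  from card_mono[OF _ this] have "la ! Suc i \<le> inner_shape n la T i"
    using i by (simp add: inner_shape_def)
  moreover have "card {j. j < la ! i \<and> T (i, j) < n} \<le> card {..<la ! i}"
    by (rule card_mono) auto
  ultimately show "inner_shape n la T i \<in> {la ! Suc i..la ! i}"
    using i by (simp add: inner_shape_def)
qed (simp add: inner_shape_def)

lemma cells_map_upt: "(i, j) \<in> cells (map mu [0..<n]) \<longleftrightarrow> i < n \<and> j < mu i"
  by (auto simp: cells_def)

text \<open>Removing the entries \<open>n\<close> maps tableaux bijectively to pairs of an
  interlacing shape \<open>mu\<close> and a tableau of shape \<open>mu\<close> with entries below
  \<open>n\<close>. The removed cells account for the power of \<open>x n\<close>.\<close>

lemma schur_poly_branch:
  fixes x :: "nat \<Rightarrow> 'a::comm_ring_1"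
  shows "schur_poly (Suc n) x la = (\<Sum>mu\<in>Pi\<^sub>E {..<n} (\<lambda>i. {la ! Suc i..la ! i}).
    x n ^ (la ! n) * (\<Prod>i<n. x n ^ (la ! i - mu i)) * schur_poly n x (map mu [0..<n]))"
proof -
  define P where "P = Pi\<^sub>E {..<n} (\<lambda>i. {la ! Suc i..la ! i})"
  have finP: "finite P" unfolding P_def by (intro finite_PiE) auto
  define sh where "sh mu = cells (map mu [0..<n])" for mu :: "nat \<Rightarrow> nat"
  define w where "w mu T = x n ^ (la ! n) * (\<Prod>i<n. x n ^ (la ! i - mu i)) * (\<Prod>c\<in>sh mu. x (T c))"
    for mu :: "nat \<Rightarrow> nat" and T
  have sh_sub: "sh mu \<subseteq> cells la" if "mu \<in> P" for mu
    using that len by (fastforce simp: sh_def cells_map_upt cells_def P_def PiE_def Pi_def)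
  have weight: "(\<Prod>c\<in>cells la. x (T c)) = w mu T'"
    if mu: "mu \<in> P" and T: "\<And>c. c \<in> cells la \<Longrightarrow> T c = (if c \<in> sh mu then T' c else n)" for T T' mu
  proof -
    \<comment> \<open>The removed strip: the end of each row \<open>i < n\<close> from column
      \<open>mu i\<close> on, and all of row \<open>n\<close>.\<close>
    have "cells la - sh mu = Sigma {..<Suc n} (\<lambda>i. {if i < n then mu i else 0..<la ! i})"
      using len by (fastforce simp: sh_def cells_map_upt cells_Sigma split: if_splits)
    then have "card (cells la - sh mu) = (\<Sum>i<n. la ! i - mu i) + la ! n"
      by simp
    then have "(\<Prod>c\<in>cells la - sh mu. x (T c)) = x n ^ ((\<Sum>i<n. la ! i - mu i) + la ! n)"
      using T by simp
    moreover have "(\<Prod>c\<in>sh mu. x (T c)) = (\<Prod>c\<in>sh mu. x (T' c))"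
      using T sh_sub[OF mu] by (intro prod.cong) auto
    moreover have "(\<Prod>c\<in>cells la. x (T c)) = (\<Prod>c\<in>cells la - sh mu. x (T c)) * (\<Prod>c\<in>sh mu. x (T c))"
      by (rule prod.subset_diff[OF sh_sub[OF mu]]) simp
    ultimately show ?thesis
      by (simp add: w_def power_add power_sum mult.commute)
  qed
  \<comment> \<open>Forward, a tableau is restricted to its inner shape; backward, the cells of the
    strip are filled with \<open>n\<close>.\<close>
  have "schur_poly (Suc n) x la =
      (\<Sum>(mu, T)\<in>Sigma P (\<lambda>mu. ssyt_below n (map mu [0..<n])). w mu T)"
    unfolding schur_poly_def
  proof (rule sum.reindex_bij_witness[where
        j = "\<lambda>T. (inner_shape n la T, restrict T (sh (inner_shape n la T)))" and
        i = "\<lambda>(mu, T). \<lambda>c\<in>cells la. if c \<in> sh mu then T c else n"])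
    fix T assume T: "T \<in> ssyt_below (Suc n) la"
    define mu where "mu = inner_shape n la T"
    have T': "T \<in> ssyt la" "\<And>c. c \<in> cells la \<Longrightarrow> T c < Suc n" using T by (auto simp: ssyt_below_def)
    have mu: "mu \<in> P" using inner_shape_interlaces[OF T] by (simp add: P_def mu_def)
    have sh: "c \<in> sh mu \<longleftrightarrow> T c < n" if "c \<in> cells la" for c
      using inner_cells_iff[OF T] that by (cases c) (auto simp: sh_def cells_map_upt mu_def)
    have Tc: "T c = (if c \<in> sh mu then restrict T (sh mu) c else n)" if "c \<in> cells la" for c
      using sh[OF that] T'(2)[OF that] by auto
    show "(case (inner_shape n la T, restrict T (sh (inner_shape n la T))) of
        (mu, T) \<Rightarrow> \<lambda>c\<in>cells la. if c \<in> sh mu then T c else n) = T"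
      using Tc ssytD(1)[OF T'(1)] by (auto simp: fun_eq_iff extensional_def simp flip: mu_def)
    show "(case (inner_shape n la T, restrict T (sh (inner_shape n la T))) of (mu, T) \<Rightarrow> w mu T) =
        (\<Prod>c\<in>cells la. x (T c))"
      using weight[OF mu, of T "restrict T (sh mu)", OF Tc] unfolding mu_def[symmetric] prod.case
      by (rule sym)
    have "restrict T (sh mu) \<in> ssyt_below n (map mu [0..<n])"
    proof -
      have "T c < n" if "c \<in> sh mu" for c using sh[of c] sh_sub[OF mu] that by blast
      then show ?thesis
        using ssytD(2,3)[OF T'(1)] sh_sub[OF mu]
        by (auto simp: ssyt_below_def ssyt_def subset_iff simp flip: sh_def)
    qed
    then show "(inner_shape n la T, restrict T (sh (inner_shape n la T))) \<in>
        Sigma P (\<lambda>mu. ssyt_below n (map mu [0..<n]))"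
      using mu by (simp flip: mu_def)
  next
    fix p assume "p \<in> Sigma P (\<lambda>mu. ssyt_below n (map mu [0..<n]))"
    then obtain mu T where p: "p = (mu, T)" and mu: "mu \<in> P"
      and T: "T \<in> ssyt (map mu [0..<n])" "\<And>c. c \<in> sh mu \<Longrightarrow> T c < n"
      by (auto simp: ssyt_below_def sh_def)
    define U where "U = (\<lambda>c\<in>cells la. if c \<in> sh mu then T c else n)"
    have mub: "la ! Suc i \<le> mu i" "mu i \<le> la ! i" if "i < n" for i
      using mu that by (auto simp: P_def PiE_def Pi_def)
    have row: "U (i, j) \<le> U (i, j')" if "(i, j) \<in> cells la" "(i, j') \<in> cells la" "j < j'" for i j j'
    proof (cases "(i, j') \<in> sh mu")
      case True
      then have "(i, j) \<in> sh mu" using that by (simp add: sh_def cells_map_upt)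
      then show ?thesis
        using ssytD(2)[OF T(1)] True that by (simp add: U_def sh_def)
    next
      case False
      then show ?thesis using that T(2)[of "(i, j)"] by (auto simp: U_def)
    qed
    \<comment> \<open>Interlacing puts every cell that has another one below it into the inner
      shape, so no column receives \<open>n\<close> twice.\<close>
    have col: "U (i, j) < U (i', j)" if "(i, j) \<in> cells la" "(i', j) \<in> cells la" "i < i'" for i i' j
    proof -
      have "la ! i' \<le> la ! Suc i"
        using that len sorted_wrt_nth_less[OF dec, of "Suc i" i'] by (cases "Suc i = i'") (auto simp: cells_def)
      then have ij: "(i, j) \<in> sh mu"
        using that len mub[of i] by (auto simp: sh_def cells_map_upt cells_def)
      show ?thesis
      proof (cases "(i', j) \<in> sh mu")
        case True
        then show ?thesis
          using ssytD(3)[OF T(1)] ij that by (simp add: U_def sh_def)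
      next
        case False
        then show ?thesis using ij T(2)[OF ij] that by (auto simp: U_def)
      qed
    qed
    have U: "U \<in> ssyt_below (Suc n) la"
      using row col T(2) by (auto simp: ssyt_below_def ssyt_def U_def less_Suc_eq)
    have "{j. j < la ! i \<and> U (i, j) < n} = {..<mu i}" if "i < n" for i
      using that mub[OF that] len T(2) by (auto simp: U_def sh_def cells_map_upt cells_def)
    then have shU: "inner_shape n la U = mu"
      using mu by (auto simp: inner_shape_def P_def fun_eq_iff PiE_def extensional_def)
    have "restrict U (sh mu) = T"
      using sh_sub[OF mu] extensional_arb[OF ssytD(1)[OF T(1)]]
      by (auto simp: U_def fun_eq_iff restrict_def simp flip: sh_def)
    with shU show "(inner_shape n la (case p of (mu, T) \<Rightarrow> \<lambda>c\<in>cells la. if c \<in> sh mu then T c else n),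
         restrict (case p of (mu, T) \<Rightarrow> \<lambda>c\<in>cells la. if c \<in> sh mu then T c else n)
          (sh (inner_shape n la (case p of (mu, T) \<Rightarrow> \<lambda>c\<in>cells la. if c \<in> sh mu then T c else n)))) = p"
      by (simp add: p flip: U_def)
    show "(case p of (mu, T) \<Rightarrow> \<lambda>c\<in>cells la. if c \<in> sh mu then T c else n) \<in> ssyt_below (Suc n) la"
      using U by (simp add: p U_def)
  qed
  also have "\<dots> = (\<Sum>mu\<in>P. \<Sum>T\<in>ssyt_below n (map mu [0..<n]). w mu T)"
    using finP by (simp add: sum.Sigma)
  finally show ?thesis
    by (simp add: P_def w_def schur_poly_def sum_distrib_left sh_def)
qed

end

section \<open>The bialternant formula\<close>

definition alternant :: "nat \<Rightarrow> (nat \<Rightarrow> 'a::comm_ring_1) \<Rightarrow> (nat \<Rightarrow> nat) \<Rightarrow> 'a" where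
  "alternant n x l = det (mat n n (\<lambda>(i, j). x i ^ l j))"

text \<open>The geometric sum for \<open>x ^ (a - b) - y ^ (a - b)\<close> times
  \<open>x ^ b\<close>. The index is the exponent of \<open>x\<close>, which becomes the exponent of
  a column in the smaller alternant.\<close>

lemma power_diff_sum:
  fixes x y :: "'a::comm_ring_1"
  assumes "b \<le> a"
  shows "x ^ a - y ^ (a - b) * x ^ b = (x - y) * (\<Sum>t\<in>{b..<a}. x ^ t * y ^ (a - 1 - t))"
proof -
  have "x ^ (a - b) - y ^ (a - b) = (x - y) * (\<Sum>i<a - b. x ^ i * y ^ (a - b - 1 - i))"
    by (subst power_diff_sumr2) (auto simp: mult.commute intro!: sum.cong)
  moreover have "x ^ a = x ^ (a - b) * x ^ b"
    using assms by (simp flip: power_add)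
  ultimately have "x ^ a - y ^ (a - b) * x ^ b = (x - y) * (\<Sum>i<a - b. x ^ i * y ^ (a - b - 1 - i)) * x ^ b"
    by (metis left_diff_distrib)
  also have "\<dots> = (x - y) * (\<Sum>i<a - b. x ^ (i + b) * y ^ (a - 1 - (i + b)))"
    by (simp add: sum_distrib_left sum_distrib_right power_add algebra_simps)
  also have "(\<Sum>i<a - b. x ^ (i + b) * y ^ (a - 1 - (i + b))) = (\<Sum>t\<in>{b..<a}. x ^ t * y ^ (a - 1 - t))"
    by (rule sum.reindex_bij_witness[of _ "\<lambda>t. t - b" "\<lambda>i. i + b"]) auto
  finally show ?thesis .
qed

lemma permutes_below: "p permutes {0..<n} \<Longrightarrow> i < n \<Longrightarrow> p i < n" for n :: nat
  using permutes_in_image[of p "{0..<n}" i] by simp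

text \<open>Subtracting \<open>y\<^bsup>l\<^sub>j - l\<^bsub>j+1\<^esub>\<^esup>\<close> times column \<open>j + 1\<close> from column \<open>j\<close>, where \<open>y = x\<^sub>n\<close>, clears the
  last row except for its last entry and makes the other rows divisible by \<open>x\<^sub>i - y\<close>.\<close>

lemma alternant_branch:
  fixes x :: "nat \<Rightarrow> 'a::comm_ring_1"
  assumes dec: "\<And>j. j < n \<Longrightarrow> l (Suc j) \<le> l j"
  shows "alternant (Suc n) x l =
    x n ^ l n * (\<Prod>i<n. x i - x n) *
      (\<Sum>t\<in>Pi\<^sub>E {..<n} (\<lambda>j. {l (Suc j)..<l j}).
         (\<Prod>j<n. x n ^ (l j - 1 - t j)) * alternant n x t)"
proof -
  define y where "y = x n"
  define A where "A = mat (Suc n) (Suc n) (\<lambda>(i, j). x i ^ l j)"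
  \<comment> \<open>The unitriangular matrix of the column operations, of determinant 1.\<close>
  define C where "C = mat (Suc n) (Suc n) (\<lambda>(i, j). if i = j then 1
      else if i = Suc j then - (y ^ (l j - l (Suc j))) else 0 :: 'a)"
  have Ac: "A \<in> carrier_mat (Suc n) (Suc n)" and Cc: "C \<in> carrier_mat (Suc n) (Suc n)"
    by (simp_all add: A_def C_def)
  have "det C = prod_list (diag_mat C)"
    by (rule det_lower_triangular[OF _ Cc]) (auto simp: C_def)
  also have "diag_mat C = map (\<lambda>_. 1) [0..<Suc n]"
    unfolding diag_mat_def by (auto simp: C_def simp del: upt_Suc)
  also have "prod_list \<dots> = 1"
    by (induct n) simp_all
  finally have detC: "det C = 1" .
  define g where "g i j = (\<Sum>t\<in>{l (Suc j)..<l j}. x i ^ t * y ^ (l j - 1 - t))" for i j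
  have AC: "(A * C) $$ (i, j) = (if j < n then (x i - y) * g i j else x i ^ l n)"
    if "i < Suc n" "j < Suc n" for i j
  proof -
    have "(A * C) $$ (i, j) = (\<Sum>k<Suc n. x i ^ l k * C $$ (k, j))"
      using that Ac Cc
      by (simp add: scalar_prod_def A_def row_def col_def atLeast0LessThan del: sum.lessThan_Suc)
    also have "\<dots> = (\<Sum>k<Suc n. (if k = j then x i ^ l j else 0) +
        (if k = Suc j then - (y ^ (l j - l (Suc j)) * x i ^ l (Suc j)) else 0))"
      using that by (intro sum.cong) (auto simp: C_def)
    also have "\<dots> = x i ^ l j + (if Suc j < Suc n then - (y ^ (l j - l (Suc j)) * x i ^ l (Suc j)) else 0)"
      using that by (simp add: sum.distrib del: sum.lessThan_Suc)
    also have "\<dots> = (if j < n then (x i - y) * g i j else x i ^ l n)"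
      using that dec[of j] power_diff_sum[of "l (Suc j)" "l j" "x i" y]
      by (auto simp: g_def less_Suc_eq)
    finally show ?thesis .
  qed
  have ACc: "A * C \<in> carrier_mat (Suc n) (Suc n)"
    using Ac Cc by simp
  have del: "mat_delete (A * C) n n = mat n n (\<lambda>(i, j). (x i - y) * g i j)"
    using AC carrier_matD(1)[OF Ac] carrier_matD(2)[OF Cc] by (intro eq_matI) (auto simp: mat_delete_def simp del: index_mult_mat(1))
  have "alternant (Suc n) x l = det (A * C)"
    using det_mult[OF Ac Cc] detC by (simp add: alternant_def A_def)
  \<comment> \<open>In row \<open>n\<close> the factor \<open>x n - y\<close> vanishes, so only the
    last summand of the Laplace expansion survives.\<close>
  also have "\<dots> = (\<Sum>j<Suc n. (A * C) $$ (n, j) * cofactor (A * C) n j)"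
    by (rule laplace_expansion_row[OF ACc]) simp
  also have "\<dots> = y ^ l n * det (mat_delete (A * C) n n)"
    by (simp add: AC y_def cofactor_def flip: mult_2)
  also have "det (mat_delete (A * C) n n) =
      (\<Sum>p | p permutes {0..<n}. signof p * (\<Prod>j<n. (x (p j) - y) * g (p j) j))"
    unfolding del by (subst det_col[where n = n]) (auto intro!: sum.cong prod.cong simp: permutes_below)
  \<comment> \<open>Multilinearity in the columns: one exponent \<open>t j\<close> is chosen from
    the geometric sum of each column \<open>j\<close>. The linear factors form the same product for
    every permutation.\<close>
  also have "\<dots> = (\<Sum>p | p permutes {0..<n}. signof p * ((\<Prod>i<n. x i - y) *
      (\<Sum>t\<in>Pi\<^sub>E {..<n} (\<lambda>j. {l (Suc j)..<l j}). \<Prod>j<n. x (p j) ^ t j * y ^ (l j - 1 - t j))))"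
  proof (intro sum.cong refl)
    fix p assume "p \<in> {p. p permutes {0..<n}}"
    then have p: "p permutes {..<n}" by (simp add: atLeast0LessThan)
    have "(\<Prod>j<n. x (p j) - y) = (\<Prod>i<n. x i - y)"
      using prod.permute[OF p, of "\<lambda>i. x i - y"] by (simp add: o_def)
    moreover have "(\<Prod>j<n. g (p j) j) =
       (\<Sum>t\<in>Pi\<^sub>E {..<n} (\<lambda>j. {l (Suc j)..<l j}). \<Prod>j<n. x (p j) ^ t j * y ^ (l j - 1 - t j))"
      unfolding g_def by (rule prod_sum_PiE) auto
    ultimately show "signof p * (\<Prod>j<n. (x (p j) - y) * g (p j) j) = signof p * ((\<Prod>i<n. x i - y) *
      (\<Sum>t\<in>Pi\<^sub>E {..<n} (\<lambda>j. {l (Suc j)..<l j}). \<Prod>j<n. x (p j) ^ t j * y ^ (l j - 1 - t j)))"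
      by (simp add: prod.distrib)
  qed
  also have "\<dots> = (\<Prod>i<n. x i - y) * (\<Sum>t\<in>Pi\<^sub>E {..<n} (\<lambda>j. {l (Suc j)..<l j}).
      (\<Prod>j<n. y ^ (l j - 1 - t j)) * (\<Sum>p | p permutes {0..<n}. signof p * (\<Prod>j<n. x (p j) ^ t j)))"
    unfolding sum_distrib_left
    by (subst sum.swap) (simp add: prod.distrib sum_distrib_left algebra_simps)
  also have "\<dots> = (\<Prod>i<n. x i - y) * (\<Sum>t\<in>Pi\<^sub>E {..<n} (\<lambda>j. {l (Suc j)..<l j}).
      (\<Prod>j<n. y ^ (l j - 1 - t j)) * alternant n x t)"
    unfolding alternant_def
    by (subst det_col[where n = n]) (auto intro!: sum.cong prod.cong arg_cong2[where f = "(*)"] simp: permutes_below)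
  finally show ?thesis
    by (simp add: y_def mult.assoc)
qed


lemma alternant_cong: "(\<And>j. j < n \<Longrightarrow> l j = l' j) \<Longrightarrow> alternant n x l = alternant n x l'"
  unfolding alternant_def by (intro arg_cong[where f = det] eq_matI) auto

text \<open>The orientation \<open>x i - x j\<close> for \<open>i < j\<close> fits the decreasing
  staircase exponents \<open>n - 1 - j\<close> of the alternant.\<close>

definition vandermonde :: "nat \<Rightarrow> (nat \<Rightarrow> 'a::comm_ring_1) \<Rightarrow> 'a" where
  "vandermonde n x = (\<Prod>j<n. \<Prod>i<j. x i - x j)"

text \<open>Both sides obey the same recursion in the number of variables:
  \<open>alternant_branch\<close> on the left, \<open>schur_poly_branch\<close> on the right, with
  \<open>\<Prod>i<n. x i - x n\<close> as the new Vandermonde factors.\<close>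

theorem bialternant:
  fixes x :: "nat \<Rightarrow> 'a::comm_ring_1"
  assumes "length la = n" "sorted_wrt (\<ge>) la"
  shows "alternant n x (\<lambda>j. la ! j + (n - 1 - j)) = vandermonde n x * schur_poly n x la"
  using assms
proof (induction n arbitrary: la)
  case 0
  have "ssyt_below 0 [] = {\<lambda>_. undefined}"
    by (auto simp: ssyt_below_def ssyt_def cells_def)
  then show ?case
    using 0 by (simp add: alternant_def vandermonde_def schur_poly_def cells_def)
next
  case (Suc n)
  define l where "l j = la ! j + (n - j)" for j
  \<comment> \<open>The staircase for \<open>n\<close> variables, one less than that for
    \<open>n + 1\<close>. This offset turns the half-open range of \<open>t j = mu j + d j\<close>
    into the closed interlacing range of \<open>mu j\<close>.\<close>
  define d where "d j = n - 1 - j" for j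
  have ld: "l j = la ! j + Suc (d j)" "l (Suc j) = la ! Suc j + d j" if "j < n" for j
    using that by (auto simp: l_def d_def)
  have le: "la ! Suc j \<le> la ! j" if "j < n" for j
    using that Suc.prems sorted_wrt_nth_less[OF Suc.prems(2), of j "Suc j"] by simp
  have IH: "alternant n x (\<lambda>j. mu j + d j) = vandermonde n x * schur_poly n x (map mu [0..<n])"
    if mu: "mu \<in> Pi\<^sub>E {..<n} (\<lambda>i. {la ! Suc i..la ! i})" for mu
  proof -
    have "mu j \<le> mu i" if "i < j" "j < n" for i j
    proof -
      have "mu j \<le> la ! j" "la ! Suc i \<le> mu i"
        using mu that by (auto simp: PiE_def Pi_def)
      moreover have "la ! j \<le> la ! Suc i"
        using that Suc.prems sorted_wrt_nth_less[OF Suc.prems(2), of "Suc i" j] by (cases "Suc i = j") auto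
      ultimately show ?thesis by simp
    qed
    then have "sorted_wrt (\<ge>) (map mu [0..<n])"
      by (simp add: sorted_wrt_iff_nth_less)
    then have "alternant n x (\<lambda>j. map mu [0..<n] ! j + (n - 1 - j)) =
        vandermonde n x * schur_poly n x (map mu [0..<n])"
      by (intro Suc.IH) auto
    then show ?thesis
      by (subst (asm) alternant_cong[where l' = "\<lambda>j. mu j + d j"]) (auto simp: d_def)
  qed
  have "alternant (Suc n) x (\<lambda>j. la ! j + (Suc n - 1 - j)) = alternant (Suc n) x l"
    by (rule alternant_cong) (simp add: l_def)
  also have "\<dots> = x n ^ l n * (\<Prod>i<n. x i - x n) *
      (\<Sum>t\<in>Pi\<^sub>E {..<n} (\<lambda>j. {l (Suc j)..<l j}). (\<Prod>j<n. x n ^ (l j - 1 - t j)) * alternant n x t)"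
    by (rule alternant_branch) (use le in \<open>fastforce simp: l_def\<close>)
  also have "(\<Sum>t\<in>Pi\<^sub>E {..<n} (\<lambda>j. {l (Suc j)..<l j}). (\<Prod>j<n. x n ^ (l j - 1 - t j)) * alternant n x t) =
      (\<Sum>mu\<in>Pi\<^sub>E {..<n} (\<lambda>i. {la ! Suc i..la ! i}). (\<Prod>i<n. x n ^ (la ! i - mu i)) *
        alternant n x (\<lambda>j. mu j + d j))"
  proof (rule sum.reindex_bij_witness[where i = "\<lambda>mu. \<lambda>j\<in>{..<n}. mu j + d j"
        and j = "\<lambda>t. \<lambda>j\<in>{..<n}. t j - d j"])
    fix t assume t: "t \<in> Pi\<^sub>E {..<n} (\<lambda>j. {l (Suc j)..<l j})"
    have tb: "la ! Suc j + d j \<le> t j \<and> t j < la ! j + Suc (d j)" if "j < n" for j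
      using t that by (fastforce simp: PiE_def Pi_def ld)
    have tb': "t j - d j + d j = t j" if "j < n" for j
      using tb[OF that] by simp
    show "(\<lambda>j\<in>{..<n}. (\<lambda>j\<in>{..<n}. t j - d j) j + d j) = t"
      using t tb' by (auto simp: fun_eq_iff PiE_def extensional_def)
    have "la ! Suc j \<le> t j - d j \<and> t j - d j \<le> la ! j" if "j < n" for j
      using tb[OF that] by linarith
    then show "(\<lambda>j\<in>{..<n}. t j - d j) \<in> Pi\<^sub>E {..<n} (\<lambda>i. {la ! Suc i..la ! i})"
      by auto
    have ex: "la ! j - (t j - d j) = l j - 1 - t j" if "j < n" for j
      using tb[OF that] by (simp add: ld[OF that])
    have "alternant n x (\<lambda>j. (\<lambda>j\<in>{..<n}. t j - d j) j + d j) = alternant n x t"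
      by (rule alternant_cong) (use tb' in simp)
    moreover have "(\<Prod>i<n. x n ^ (la ! i - (\<lambda>j\<in>{..<n}. t j - d j) i)) = (\<Prod>j<n. x n ^ (l j - 1 - t j))"
      by (rule prod.cong) (use ex in auto)
    ultimately show "(\<Prod>i<n. x n ^ (la ! i - (\<lambda>j\<in>{..<n}. t j - d j) i)) *
        alternant n x (\<lambda>j. (\<lambda>j\<in>{..<n}. t j - d j) j + d j) =
        (\<Prod>j<n. x n ^ (l j - 1 - t j)) * alternant n x t"
      by simp
  next
    fix mu assume mu: "mu \<in> Pi\<^sub>E {..<n} (\<lambda>i. {la ! Suc i..la ! i})"
    show "(\<lambda>j\<in>{..<n}. (\<lambda>j\<in>{..<n}. mu j + d j) j - d j) = mu"
      using mu by (auto simp: fun_eq_iff PiE_def extensional_def)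
    have "la ! Suc j + d j \<le> mu j + d j \<and> mu j + d j < la ! j + Suc (d j)" if "j < n" for j
    proof -
      have "la ! Suc j \<le> mu j" "mu j \<le> la ! j"
        using mu that by (auto simp: PiE_def Pi_def)
      then show ?thesis using that by linarith
    qed
    then show "(\<lambda>j\<in>{..<n}. mu j + d j) \<in> Pi\<^sub>E {..<n} (\<lambda>j. {l (Suc j)..<l j})"
      by (auto simp: ld)
  qed
  also have "x n ^ l n * (\<Prod>i<n. x i - x n) * \<dots> = (vandermonde n x * (\<Prod>i<n. x i - x n)) *
      (\<Sum>mu\<in>Pi\<^sub>E {..<n} (\<lambda>i. {la ! Suc i..la ! i}).
        x n ^ (la ! n) * (\<Prod>i<n. x n ^ (la ! i - mu i)) * schur_poly n x (map mu [0..<n]))"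
    unfolding sum_distrib_left by (intro sum.cong refl) (simp add: IH l_def mult_ac)
  also have "\<dots> = vandermonde (Suc n) x * schur_poly (Suc n) x la"
    by (simp add: vandermonde_def schur_poly_branch[OF Suc.prems, of x])
  finally show ?case .
qed

text \<open>The Leibniz formula by rows, in which the permutation acts on the exponents instead of
  the variables.\<close>

lemma alternant_expand:
  "alternant n x l = (\<Sum>p | p permutes {0..<n}. signof p * (\<Prod>i<n. x i ^ l (p i)))"
  unfolding alternant_def
  by (subst det_def'[where n = n]) (auto intro!: sum.cong prod.cong simp: permutes_below atLeast0LessThan)

section \<open>Quasisymmetric functions and words in the generators\<close>

definition exponent_composition :: "monomial \<Rightarrow> composition" where
  "exponent_composition x = Composition (map (Poly_Mapping.lookup x) (sorted_list_of_set (Poly_Mapping.keys x)))"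

lemma parts_exponent_composition: "parts (exponent_composition x) = map (Poly_Mapping.lookup x) (sorted_list_of_set (Poly_Mapping.keys x))"
  unfolding exponent_composition_def by (rule parts_Composition) (auto simp: in_keys_iff)

lemma monom_of_exponent_composition: "monom_of (sorted_list_of_set (Poly_Mapping.keys x)) (parts (exponent_composition x)) = x"
proof (rule poly_mapping_eqI)
  fix v
  define vs where "vs = sorted_list_of_set (Poly_Mapping.keys x)"
  have vs: "sorted_wrt (<) vs" "length vs = length (parts (exponent_composition x))" "set vs = Poly_Mapping.keys x"
    by (simp_all add: vs_def parts_exponent_composition)
  have "Poly_Mapping.lookup (monom_of vs (parts (exponent_composition x))) v = Poly_Mapping.lookup x v"
  proof (cases "v \<in> set vs")
    case True
    then obtain j where j: "j < length vs" "v = vs ! j" by (auto simp: in_set_conv_nth)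
    then show ?thesis
      using lookup_monom_of[OF vs(1,2), of j] vs(2) by (simp add: parts_exponent_composition vs_def)
  next
    case False
    then have "v \<notin> Poly_Mapping.keys (monom_of vs (parts (exponent_composition x)))"
      using keys_monom_of[OF vs(1,2)] by (auto dest: parts_pos)
    then show ?thesis using False vs(3) by (simp add: in_keys_iff)
  qed
  then show "Poly_Mapping.lookup (monom_of (sorted_list_of_set (Poly_Mapping.keys x)) (parts (exponent_composition x))) v =
      Poly_Mapping.lookup x v"
    by (simp add: vs_def)
qed

lemma exponent_composition_monom_of:
  assumes "sorted_wrt (<) vs" "length vs = length (parts \<beta>)"
  shows "exponent_composition (monom_of vs (parts \<beta>)) = \<beta>"
  using monom_of_inject(2)[OF _ _ assms monom_of_exponent_composition] by (simp add: parts_exponent_composition)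

lemma mdeg_exponent_composition: "mdeg x = sum_list (parts (exponent_composition x))"
  by (simp add: mdeg_def parts_exponent_composition sum_list_distinct_conv_sum_set)

text \<open>Quasisymmetry allows the variables of \<open>x\<close> to be replaced, in order, by the
  first ones, where \<open>M_coeff\<close> reads its value.\<close>

lemma QSym_eval:
  assumes "F \<in> QSym"
  shows "F x = M_coeff (exponent_composition x) F"
proof -
  have "sorted_wrt (<) (sorted_list_of_set (Poly_Mapping.keys x))"
    "sorted_wrt (<) [0..<length (parts (exponent_composition x))]"
    "length (sorted_list_of_set (Poly_Mapping.keys x)) = length (parts (exponent_composition x))"
    by (simp_all add: parts_exponent_composition)
  then have "F (monom_of (sorted_list_of_set (Poly_Mapping.keys x)) (parts (exponent_composition x))) =
      F (monom_of [0..<length (parts (exponent_composition x))] (parts (exponent_composition x)))"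
    using assms unfolding QSym_def by auto
  then show ?thesis by (simp add: monom_of_exponent_composition M_coeff_def)
qed

lemma QSym_eqI:
  assumes "F \<in> QSym" "G \<in> QSym" "\<And>\<alpha>. M_coeff \<alpha> F = M_coeff \<alpha> G"
  shows "F = G"
  using assms by (auto simp: fun_eq_iff QSym_eval)

lemma QSymI:
  assumes "\<And>x. F x \<noteq> 0 \<Longrightarrow> mdeg x \<le> d" "\<And>x y. exponent_composition x = exponent_composition y \<Longrightarrow> F x = F y"
  shows "F \<in> QSym"
  unfolding QSym_def using assms(1) by (auto intro!: assms(2) simp: exponent_composition_monom_of)

lemma of_coeff_QSym:
  assumes "\<And>\<alpha>. c \<alpha> \<noteq> 0 \<Longrightarrow> sum_list (parts \<alpha>) \<le> d"
  shows "(\<lambda>x. c (exponent_composition x)) \<in> QSym"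
  by (rule QSymI[of _ d]) (auto simp: mdeg_exponent_composition assms)

lemma M_coeff_of_coeff [simp]: "M_coeff \<beta> (\<lambda>x. c (exponent_composition x)) = c \<beta>"
  by (simp add: M_coeff_def exponent_composition_monom_of)

lemma M_eq: "M \<beta> x = (if exponent_composition x = \<beta> then 1 else 0)"
proof -
  have "\<exists>vs. sorted_wrt (<) vs \<and> length vs = length (parts \<beta>) \<and> x = monom_of vs (parts \<beta>)"
    if "exponent_composition x = \<beta>"
    using monom_of_exponent_composition[of x, symmetric] that
    by (intro exI[of _ "sorted_list_of_set (Poly_Mapping.keys x)"]) (auto simp: parts_exponent_composition)
  then show ?thesis
    by (auto simp: M_def exponent_composition_monom_of)
qed

lemma M_QSym: "M \<beta> \<in> QSym"
  by (rule QSymI[of _ "sum_list (parts \<beta>)"]) (auto simp: M_eq mdeg_exponent_composition split: if_splits)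

lemma QSym_lincomb:
  assumes "finite I" "\<And>i. i \<in> I \<Longrightarrow> F i \<in> QSym"
  shows "(\<lambda>x. \<Sum>i\<in>I. c i * F i x) \<in> QSym"
proof -
  have "\<forall>i\<in>I. \<exists>d. \<forall>x. F i x \<noteq> 0 \<longrightarrow> mdeg x \<le> d"
    using assms(2) by (auto simp: QSym_def)
  then obtain d where d: "\<And>i x. i \<in> I \<Longrightarrow> F i x \<noteq> 0 \<Longrightarrow> mdeg x \<le> d i" by metis
  show ?thesis
  proof (rule QSymI[of _ "\<Sum>i\<in>I. d i"])
    fix x assume "(\<Sum>i\<in>I. c i * F i x) \<noteq> 0"
    then obtain i where "i \<in> I" "c i * F i x \<noteq> 0"
      by (rule sum.not_neutral_contains_not_neutral)
    then have i: "i \<in> I" "F i x \<noteq> 0" by auto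
    have "mdeg x \<le> d i" using d i by blast
    also have "\<dots> \<le> (\<Sum>i\<in>I. d i)" using assms(1) i(1) by (simp add: member_le_sum)
    finally show "mdeg x \<le> (\<Sum>i\<in>I. d i)" .
  qed (use assms(2) in \<open>auto simp: QSym_eval intro!: sum.cong\<close>)
qed

text \<open>Exponents may be zero here, as they are after a letter 1 has been lowered.\<close>

definition exponents :: "nat \<Rightarrow> (nat \<Rightarrow> nat) \<Rightarrow> monomial" where
  "exponents m e = (\<Sum>i<m. Poly_Mapping.single i (e i))"

lemma lookup_exponents: "Poly_Mapping.lookup (exponents m e) v = (if v < m then e v else 0)"
proof -
  have "Poly_Mapping.lookup (exponents m e) v = (\<Sum>i<m. if i = v then e i else 0)"
    unfolding exponents_def lookup_sum by (intro sum.cong) (auto simp: lookup_single when_def)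
  then show ?thesis by simp
qed

lemma exponent_composition_exponents: "exponent_composition (exponents m e) = Composition (filter (\<lambda>a. 0 < a) (map e [0..<m]))"
proof -
  have "sorted_list_of_set (Poly_Mapping.keys (exponents m e)) = filter (\<lambda>i. 0 < e i) [0..<m]"
    by (rule strict_sorted_equal) (auto simp: in_keys_iff lookup_exponents sorted_wrt_filter split: if_splits)
  then have "map (Poly_Mapping.lookup (exponents m e)) (sorted_list_of_set (Poly_Mapping.keys (exponents m e))) =
      map e (filter (\<lambda>i. 0 < e i) [0..<m])"
    by (simp add: lookup_exponents)
  also have "\<dots> = filter (\<lambda>a. 0 < a) (map e [0..<m])"
    by (simp add: filter_map o_def)
  finally show ?thesis by (simp add: exponent_composition_def)
qed

section \<open>Words with integer letters and their pairing\<close>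

definition Hprod :: "int list \<Rightarrow> nsym" where
  "Hprod g = prod_list (map H g)"

lemma Hprod_simps [simp]: "Hprod [] = 1" "Hprod (r # g) = H r * Hprod g"
  by (simp_all add: Hprod_def)

lemma Hprod_parts: "Hprod (map int (parts \<alpha>)) = Poly_Mapping.single \<alpha> 1"
  using prod_list_H[of \<alpha>] by (simp add: Hprod_def o_def)

lemma Composition_Cons:
  assumes "0 < a" "\<And>b. b \<in> set xs \<Longrightarrow> 0 < b"
  shows "Composition [a] + Composition xs = Composition (a # xs)"
proof -
  have "parts (Composition [a]) = [a]" "parts (Composition xs) = xs"
    using assms by (auto intro!: parts_Composition)
  then show ?thesis by (simp add: plus_composition_def)
qed

text \<open>A zero letter disappears because \<open>H 0 = 1\<close>, and a negative one kills the
  word. Lowering letters and Laurent exponents both lead to such words.\<close>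

lemma Hprod_eq:
  "Hprod g = (if \<exists>r\<in>set g. r < 0 then 0 else
     Poly_Mapping.single (Composition (filter (\<lambda>a. 0 < a) (map nat g))) 1)"
proof (induction g)
  case Nil
  show ?case by (simp flip: zero_composition_def)
next
  case (Cons r g)
  have "Composition [nat r] + Composition (filter (\<lambda>a. 0 < a) (map nat g)) =
      Composition (nat r # filter (\<lambda>a. 0 < a) (map nat g))" if "0 < r"
    using that by (intro Composition_Cons) auto
  with Cons show ?case
    by (cases r "0 :: int" rule: linorder_cases) (simp_all add: H_def mult_single)
qed

lemma pairing_superset:
  assumes "finite A" "Poly_Mapping.keys h \<subseteq> A"
  shows "pairing h F = (\<Sum>\<alpha>\<in>A. Poly_Mapping.lookup h \<alpha> * M_coeff \<alpha> F)"
  unfolding pairing_def using assms by (intro sum.mono_neutral_left) (auto simp: in_keys_iff)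

lemma pairing_zero [simp]: "pairing 0 F = 0"
  by (simp add: pairing_def)

lemma pairing_single [simp]: "pairing (Poly_Mapping.single \<alpha> c) F = c * M_coeff \<alpha> F"
  by (subst pairing_superset[of "{\<alpha>}"]) auto

lemma pairing_add: "pairing (h + k) F = pairing h F + pairing k F"
  unfolding pairing_def by (rule setsum_keys_plus_distrib) (simp_all add: algebra_simps)

lemma pairing_sum: "pairing (\<Sum>i\<in>I. h i) F = (\<Sum>i\<in>I. pairing (h i) F)"
  by (induction I rule: infinite_finite_induct) (simp_all add: pairing_add)

abbreviation const :: "rat \<Rightarrow> 'a::monoid_add \<Rightarrow>\<^sub>0 rat" where
  "const c \<equiv> Poly_Mapping.single 0 c"

lemma lookup_const_mult: "Poly_Mapping.lookup (const c * h) a = c * Poly_Mapping.lookup h a"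
  by (simp flip: mult_map_scale_conv_mult add: map.rep_eq when_def)

lemma pairing_const: "pairing (const c * h) F = c * pairing h F"
  by (subst pairing_superset[of "Poly_Mapping.keys h"])
     (auto simp: lookup_const_mult in_keys_iff pairing_def sum_distrib_left mult.assoc)

lemma poly_mapping_expand:
  "h = (\<Sum>a\<in>Poly_Mapping.keys h. Poly_Mapping.single a (Poly_Mapping.lookup h a))"
proof (rule poly_mapping_eqI)
  fix b
  have "(\<Sum>a\<in>Poly_Mapping.keys h. Poly_Mapping.lookup (Poly_Mapping.single a (Poly_Mapping.lookup h a)) b) =
     (\<Sum>a\<in>Poly_Mapping.keys h. if a = b then Poly_Mapping.lookup h b else 0)"
    by (intro sum.cong) (auto simp: lookup_single)
  also have "\<dots> = Poly_Mapping.lookup h b"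
    by (simp add: in_keys_iff)
  finally show "Poly_Mapping.lookup h b =
    Poly_Mapping.lookup (\<Sum>a\<in>Poly_Mapping.keys h. Poly_Mapping.single a (Poly_Mapping.lookup h a)) b"
    by (simp add: lookup_sum)
qed

text \<open>The key monoid need not commute, but a scalar sits at its neutral element and is
  therefore central.\<close>

lemma const_mult_commute: "const c * h = h * const c" for h :: "'a::monoid_add \<Rightarrow>\<^sub>0 rat"
proof -
  have "const c * (\<Sum>a\<in>A. Poly_Mapping.single a (f a)) = (\<Sum>a\<in>A. Poly_Mapping.single a (f a)) * const c"
    for A :: "'a set" and f
    by (simp add: sum_distrib_left sum_distrib_right mult_single mult.commute)
  from this[of "Poly_Mapping.lookup h" "Poly_Mapping.keys h"] show ?thesis
    by (simp flip: poly_mapping_expand)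
qed

text \<open>Nondegeneracy: pairing with \<open>M \<alpha>\<close> reads off the coefficient at
  \<open>\<alpha>\<close>. It gives the uniqueness in the definition of \<open>perp\<close>.\<close>

lemma pairing_eqI:
  assumes "\<And>G. G \<in> QSym \<Longrightarrow> pairing h G = pairing k G"
  shows "h = k"
proof (rule poly_mapping_eqI)
  fix \<alpha>
  have "pairing h (M \<alpha>) = Poly_Mapping.lookup h \<alpha>" for h
  proof -
    have "M_coeff \<beta> (M \<alpha>) = (if \<beta> = \<alpha> then 1 else 0)" for \<beta>
      by (simp add: M_coeff_def M_eq exponent_composition_monom_of)
    then show ?thesis
      by (simp add: pairing_def in_keys_iff if_distrib[of "(*) _"] cong: if_cong)
  qed
  from this[of h] this[of k] show "Poly_Mapping.lookup h \<alpha> = Poly_Mapping.lookup k \<alpha>"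
    using assms[OF M_QSym[of \<alpha>]] by simp
qed

lemma map_rev_upt: "map f (rev [0..<m]) = map (\<lambda>a. f (m - 1 - a)) [0..<m]"
  by (rule nth_equalityI) (simp_all add: rev_nth)

text \<open>The pairing of a word is the coefficient of \<open>G\<close> at the monomial with the
  letters as exponents; zero letters are dropped on both sides. The word is read from variable
  \<open>m - 1\<close> downwards, so position \<open>a\<close> carries
  \<open>g (m - 1 - a)\<close>.\<close>

lemma pairing_Hprod:
  assumes "G \<in> QSym"
  shows "pairing (Hprod (map g (rev [0..<m]))) G =
    (if \<exists>j<m. g j < 0 then 0 else G (exponents m (\<lambda>a. nat (g (m - 1 - a)))))"
proof -
  have "(\<exists>r\<in>set (map g (rev [0..<m])). r < 0) \<longleftrightarrow> (\<exists>j<m. g j < 0)"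
    by auto
  moreover have "map nat (map g (rev [0..<m])) = map (\<lambda>a. nat (g (m - 1 - a))) [0..<m]"
    unfolding map_rev_upt by simp
  moreover have "G (exponents m (\<lambda>a. nat (g (m - 1 - a)))) =
      M_coeff (Composition (filter (\<lambda>a. 0 < a) (map (\<lambda>a. nat (g (m - 1 - a))) [0..<m]))) G"
    using QSym_eval[OF assms] exponent_composition_exponents by metis
  ultimately show ?thesis
    unfolding Hprod_eq by (cases "\<exists>j<m. g j < 0") (simp_all only: if_True if_False pairing_zero pairing_single mult_1)
qed

text \<open>The action of \<open>F\<^bsub>1^i\<^esub>\<^sup>\<bottom>\<close> on the word with letters \<open>g\<close>. Since \<open>H\<^sub>0 = 1\<close> and \<open>H\<^bsub>-1\<^esub> = 0\<close>, the
  recursion is insensitive to zero letters, so it covers all integer words.\<close>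

fun Hlower :: "nat \<Rightarrow> int list \<Rightarrow> nsym" where
  "Hlower 0 [] = 1"
| "Hlower (Suc i) [] = 0"
| "Hlower 0 (r # g) = H r * Hlower 0 g"
| "Hlower (Suc i) (r # g) = H r * Hlower (Suc i) g + H (r - 1) * Hlower i g"

lemma Hlower_0: "Hlower 0 g = Hprod g"
  by (induction g) simp_all

lemma Hlower_eq_0: "length g < i \<Longrightarrow> Hlower i g = 0"
  by (induction i g rule: Hlower.induct) simp_all

text \<open>A leading zero letter is skipped, since its lowered term has the factor
  \<open>H (- 1) = 0\<close>; for a negative letter both terms vanish.\<close>

lemma Hlower_normalize:
  "Hlower i g = (if \<exists>r\<in>set g. r < 0 then 0 else Hlower i (map int (filter (\<lambda>a. 0 < a) (map nat g))))"
proof (induction i g rule: Hlower.induct)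
  case (3 r g)
  then show ?case by (cases r "0 :: int" rule: linorder_cases) (simp_all add: H_def)
next
  case (4 i r g)
  then show ?case by (cases r "0 :: int" rule: linorder_cases) (simp_all add: H_def)
qed simp_all

lemma subsets_Suc_card:
  "{S. S \<subseteq> {..<Suc m} \<and> card S = Suc i} =
    {S. S \<subseteq> {..<m} \<and> card S = Suc i} \<union> insert m ` {S. S \<subseteq> {..<m} \<and> card S = i}" (is "?L = ?R")
proof
  show "?L \<subseteq> ?R"
  proof
    fix S assume S: "S \<in> ?L"
    then have fin: "finite S" using finite_subset by blast
    show "S \<in> ?R"
    proof (cases "m \<in> S")
      case True
      then have "S = insert m (S - {m})" "S - {m} \<subseteq> {..<m}" "card (S - {m}) = i"
        using S fin by (auto simp: less_Suc_eq)
      then show ?thesis by blast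
    next
      case False
      then show ?thesis using S by (auto simp: less_Suc_eq)
    qed
  qed
  have "card (insert m S) = Suc (card S)" if "S \<subseteq> {..<m}" for S
    using that finite_subset[OF that] by (subst card_insert_disjoint) auto
  then show "?R \<subseteq> ?L" by (auto simp: less_Suc_eq)
qed

lemma finite_subsets_card [simp]: "finite {S. S \<subseteq> {..<m::nat} \<and> card S = i}"
  by (rule finite_subset[of _ "Pow {..<m}"]) auto

text \<open>\<open>S\<close> is the set of lowered letters. The recursion splits by whether the
  leading letter, which belongs to variable \<open>m\<close>, lies in \<open>S\<close>.\<close>

lemma Hlower_subsets:
  "Hlower i (map g (rev [0..<m])) = (\<Sum>S | S \<subseteq> {..<m} \<and> card S = i.
     Hprod (map (\<lambda>j. g j - of_bool (j \<in> S)) (rev [0..<m])))"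
proof (induction m arbitrary: i)
  case 0
  have "{S. S \<subseteq> {..<0::nat} \<and> card S = i} = (if i = 0 then {{}} else {})" by auto
  then show ?case by (cases i) simp_all
next
  case (Suc m)
  show ?case
  proof (cases i)
    case 0
    have "{S. S \<subseteq> {..<Suc m} \<and> card S = 0} = {{}}"
      by (auto simp: card_eq_0_iff dest: finite_subset)
    then show ?thesis using 0 by (simp add: Hlower_0 del: lessThan_Suc)
  next
    case (Suc i')
    let ?A = "\<lambda>i. {S. S \<subseteq> {..<m} \<and> card S = i}"
    let ?P = "\<lambda>S m. Hprod (map (\<lambda>j. g j - of_bool (j \<in> S)) (rev [0..<m]))"
    have "(\<Sum>S | S \<subseteq> {..<Suc m} \<and> card S = Suc i'. ?P S (Suc m)) =
        (\<Sum>S\<in>?A (Suc i'). ?P S (Suc m)) + (\<Sum>S\<in>insert m ` ?A i'. ?P S (Suc m))"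
      unfolding subsets_Suc_card by (rule sum.union_disjoint) auto
    also have "(\<Sum>S\<in>?A (Suc i'). ?P S (Suc m)) = (\<Sum>S\<in>?A (Suc i'). H (g m) * ?P S m)"
      by (rule sum.cong) auto
    also have "(\<Sum>S\<in>insert m ` ?A i'. ?P S (Suc m)) = (\<Sum>S\<in>?A i'. ?P (insert m S) (Suc m))"
    proof (rule sum.reindex_cong[OF _ refl refl])
      show "inj_on (insert m) (?A i')"
      proof (rule inj_onI)
        fix S T assume "S \<in> ?A i'" "T \<in> ?A i'" "insert m S = insert m T"
        moreover from this(1,2) have "m \<notin> S" "m \<notin> T" by auto
        ultimately show "S = T" by (simp add: insert_ident)
      qed
    qed
    also have "\<dots> = (\<Sum>S\<in>?A i'. H (g m - 1) * ?P S m)"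
    proof (rule sum.cong)
      fix S assume "S \<in> ?A i'"
      have "map (\<lambda>j. g j - of_bool (j \<in> insert m S)) (rev [0..<m]) = map (\<lambda>j. g j - of_bool (j \<in> S)) (rev [0..<m])"
        by (rule map_cong) auto
      then show "?P (insert m S) (Suc m) = H (g m - 1) * ?P S m"
        by (simp only: upt_Suc_append rev_append rev.simps append.simps list.map Hprod_simps insertI1 of_bool_eq le0)
    qed simp
    finally show ?thesis
      using Suc.IH[of "Suc i'"] Suc.IH[of i'] Suc by (simp add: sum_distrib_left)
  qed
qed

section \<open>Multiplication by elementary symmetric functions and its adjoint\<close>

lemma finite_decompositions: "finite {(y, z). y + z = (x :: monomial)}"
proof (rule finite_imageD)
  let ?f = "\<lambda>(y, z :: monomial). restrict (Poly_Mapping.lookup y) (Poly_Mapping.keys x)"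
  have le: "Poly_Mapping.lookup y v \<le> Poly_Mapping.lookup x v" if "y + z = x" for y z :: monomial and v
    using that by (auto simp: lookup_add)
  then have "?f ` {(y, z). y + z = x} \<subseteq> Pi\<^sub>E (Poly_Mapping.keys x) (\<lambda>v. {..Poly_Mapping.lookup x v})"
    by auto
  moreover have "finite (Pi\<^sub>E (Poly_Mapping.keys x) (\<lambda>v. {..Poly_Mapping.lookup x v}))"
    by (rule finite_PiE) auto
  ultimately show "finite (?f ` {(y, z). y + z = x})"
    by (rule finite_subset)
  show "inj_on ?f {(y, z). y + z = x}"
  proof (rule inj_onI, clarify)
    fix y z y' z' :: monomial
    assume x: "y' + z' = y + z" "x = y + z" and
      eq: "restrict (Poly_Mapping.lookup y) (Poly_Mapping.keys (y + z)) =
        restrict (Poly_Mapping.lookup y') (Poly_Mapping.keys (y + z))"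
    have "Poly_Mapping.lookup y v = Poly_Mapping.lookup y' v" for v
    proof (cases "v \<in> Poly_Mapping.keys (y + z)")
      case True
      then show ?thesis using fun_cong[OF eq, of v] by simp
    next
      case False
      then have "Poly_Mapping.lookup (y + z) v = 0" by (simp add: in_keys_iff)
      then have "Poly_Mapping.lookup y v = 0" "Poly_Mapping.lookup y' v = 0"
        using x(1) by (metis add_eq_0_iff_both_eq_0 lookup_add)+
      then show ?thesis by simp
    qed
    then have "y = y'" by (rule poly_mapping_eqI)
    then show "y = y' \<and> z = z'" using x(1) by simp
  qed
qed

lemma map_eq_replicate: "map f xs = replicate i c \<longleftrightarrow> length xs = i \<and> (\<forall>x\<in>set xs. f x = c)"
  by (auto simp: list_eq_iff_nth_eq all_set_conv_all_nth)

text \<open>\<open>F1 i\<close> is the elementary symmetric function: the sum of the squarefree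
  monomials in \<open>i\<close> variables.\<close>

lemma F1_eq:
  "F1 i y = (if card (Poly_Mapping.keys y) = i \<and> (\<forall>v\<in>Poly_Mapping.keys y. Poly_Mapping.lookup y v = 1)
    then 1 else 0)"
proof -
  have "exponent_composition y = Composition (replicate i 1) \<longleftrightarrow>
      parts (exponent_composition y) = parts (Composition (replicate i 1))"
    by (simp add: parts_inject)
  also have "parts (Composition (replicate i 1)) = replicate i 1"
    by (rule parts_Composition) simp
  also have "parts (exponent_composition y) = replicate i 1 \<longleftrightarrow>
      card (Poly_Mapping.keys y) = i \<and> (\<forall>v\<in>Poly_Mapping.keys y. Poly_Mapping.lookup y v = 1)"
    by (simp add: parts_exponent_composition map_eq_replicate)
  finally show ?thesis
    by (simp add: F1_def M_eq)
qed

lemma exponents_cong: "(\<And>j. j < k \<Longrightarrow> e j = e' j) \<Longrightarrow> exponents k e = exponents k e'"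
  by (simp add: exponents_def)

text \<open>A contributing factorization is determined by the support \<open>S\<close> of its
  squarefree factor. Positive exponents keep the natural subtraction from being truncated.\<close>

lemma series_mult_F1:
  assumes pos: "\<And>j. j < k \<Longrightarrow> 0 < e j"
  shows "series_mult (F1 i) G (exponents k e) =
    (\<Sum>S | S \<subseteq> {..<k} \<and> card S = i. G (exponents k (\<lambda>j. e j - of_bool (j \<in> S))))"
proof -
  let ?P = "{(y, z). y + z = exponents k e}"
  let ?Q = "{p \<in> ?P. F1 i (fst p) \<noteq> 0}"
  have "series_mult (F1 i) G (exponents k e) = (\<Sum>p\<in>?P. F1 i (fst p) * G (snd p))"
    unfolding series_mult_def by (rule sum.cong) auto
  \<comment> \<open>Only finitely many factorizations exist, so those on which \<open>F1 i\<close>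
    vanishes may be discarded.\<close>
  also have "\<dots> = (\<Sum>p\<in>?Q. F1 i (fst p) * G (snd p))"
    by (rule sum.mono_neutral_right[OF finite_decompositions]) auto
  also have "\<dots> = (\<Sum>S | S \<subseteq> {..<k} \<and> card S = i. G (exponents k (\<lambda>j. e j - of_bool (j \<in> S))))"
  proof (rule sum.reindex_bij_witness[where
        i = "\<lambda>S. (exponents k (\<lambda>j. of_bool (j \<in> S)), exponents k (\<lambda>j. e j - of_bool (j \<in> S)))" and
        j = "\<lambda>p. Poly_Mapping.keys (fst p)"])
    fix p assume p: "p \<in> ?Q"
    then obtain y z where yz: "p = (y, z)" "y + z = exponents k e" "F1 i y \<noteq> 0" by auto
    then have y: "card (Poly_Mapping.keys y) = i" "\<And>v. v \<in> Poly_Mapping.keys y \<Longrightarrow> Poly_Mapping.lookup y v = 1"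
      by (auto simp: F1_eq split: if_splits)
    have sum: "Poly_Mapping.lookup y v + Poly_Mapping.lookup z v = (if v < k then e v else 0)" for v
      using yz(2) by (metis lookup_add lookup_exponents)
    have sub: "Poly_Mapping.keys y \<subseteq> {..<k}"
    proof
      fix v assume "v \<in> Poly_Mapping.keys y"
      then show "v \<in> {..<k}" using sum[of v] y(2)[of v] by (auto split: if_splits)
    qed
    have ly: "Poly_Mapping.lookup y v = of_bool (v \<in> Poly_Mapping.keys y)" for v
      using y(2)[of v] by (cases "v \<in> Poly_Mapping.keys y") (auto simp: in_keys_iff)
    have "exponents k (\<lambda>j. of_bool (j \<in> Poly_Mapping.keys y)) = y"
      using sub by (intro poly_mapping_eqI) (auto simp: lookup_exponents ly)
    moreover have z: "exponents k (\<lambda>j. e j - of_bool (j \<in> Poly_Mapping.keys y)) = z"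
    proof (rule poly_mapping_eqI)
      fix v show "Poly_Mapping.lookup (exponents k (\<lambda>j. e j - of_bool (j \<in> Poly_Mapping.keys y))) v = Poly_Mapping.lookup z v"
        using sum[of v] ly[of v] by (auto simp: lookup_exponents split: if_splits)
    qed
    ultimately show "(exponents k (\<lambda>j. of_bool (j \<in> Poly_Mapping.keys (fst p))),
        exponents k (\<lambda>j. e j - of_bool (j \<in> Poly_Mapping.keys (fst p)))) = p"
      by (simp add: yz(1))
    show "Poly_Mapping.keys (fst p) \<in> {S. S \<subseteq> {..<k} \<and> card S = i}"
      using sub y(1) by (simp add: yz(1))
    show "G (exponents k (\<lambda>j. e j - of_bool (j \<in> Poly_Mapping.keys (fst p)))) = F1 i (fst p) * G (snd p)"
      using z y by (simp add: yz(1) F1_eq)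
  next
    fix S assume S: "S \<in> {S. S \<subseteq> {..<k} \<and> card S = i}"
    have keys: "Poly_Mapping.keys (exponents k (\<lambda>j. of_bool (j \<in> S))) = S"
      using S by (auto simp: in_keys_iff lookup_exponents split: if_splits)
    then show "Poly_Mapping.keys (fst (exponents k (\<lambda>j. of_bool (j \<in> S)), exponents k (\<lambda>j. e j - of_bool (j \<in> S)))) = S"
      by simp
    have "exponents k (\<lambda>j. of_bool (j \<in> S)) + exponents k (\<lambda>j. e j - of_bool (j \<in> S)) = exponents k e"
      using pos by (intro poly_mapping_eqI) (auto simp: lookup_exponents lookup_add Suc_leI)
    moreover have "F1 i (exponents k (\<lambda>j. of_bool (j \<in> S))) = 1"
      using S keys by (auto simp: F1_eq lookup_exponents)
    ultimately show "(exponents k (\<lambda>j. of_bool (j \<in> S)), exponents k (\<lambda>j. e j - of_bool (j \<in> S))) \<in> ?Q"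
      by simp
  qed
  finally show ?thesis .
qed

text \<open>On words, \<open>Hlower i\<close> is adjoint to multiplication by \<open>F1 i\<close>:
  lowering a subset of letters corresponds to dividing by a squarefree monomial.\<close>

lemma pairing_Hlower:
  assumes G: "G \<in> QSym"
  shows "pairing (Hlower i (map int (parts \<alpha>))) G = M_coeff \<alpha> (series_mult (F1 i) G)"
proof -
  define k where "k = length (parts \<alpha>)"
  define e where "e j = parts \<alpha> ! j" for j
  define g where "g j = int (e (k - 1 - j))" for j
  have pos: "0 < e j" if "j < k" for j
    using that parts_pos[of "parts \<alpha> ! j" \<alpha>] by (simp add: e_def k_def)
  have "map int (parts \<alpha>) = map g (rev [0..<k])"
    unfolding map_rev_upt by (rule nth_equalityI) (auto simp: k_def g_def e_def)
  then have "pairing (Hlower i (map int (parts \<alpha>))) G = (\<Sum>S | S \<subseteq> {..<k} \<and> card S = i.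
     pairing (Hprod (map (\<lambda>j. g j - of_bool (j \<in> S)) (rev [0..<k]))) G)"
    by (simp only: Hlower_subsets pairing_sum)
  also have "\<dots> = (\<Sum>S | S \<subseteq> {..<k} \<and> card S = i. G (exponents k (\<lambda>a. e a - of_bool (k - 1 - a \<in> S))))"
  proof (rule sum.cong[OF refl])
    fix S
    \<comment> \<open>Letters of a composition are at least 1, so lowering leads at worst to 0 and
      the vanishing case of \<open>pairing_Hprod\<close> does not occur.\<close>
    have "g j \<ge> 1" if "j < k" for j
      using pos[of "k - 1 - j"] that by (simp add: g_def)
    then have "\<not> (\<exists>j<k. g j - of_bool (j \<in> S) < 0)"
      by (metis diff_ge_0_iff_ge of_bool_def not_less order.trans zero_le_one order.refl)
    then have "pairing (Hprod (map (\<lambda>j. g j - of_bool (j \<in> S)) (rev [0..<k]))) G =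
        G (exponents k (\<lambda>a. nat (g (k - 1 - a) - of_bool (k - 1 - a \<in> S))))"
      unfolding pairing_Hprod[OF G] by (simp only: if_False)
    also have "exponents k (\<lambda>a. nat (g (k - 1 - a) - of_bool (k - 1 - a \<in> S))) =
        exponents k (\<lambda>a. e a - of_bool (k - 1 - a \<in> S))"
      by (rule exponents_cong) (auto simp: g_def of_bool_def)
    finally show "pairing (Hprod (map (\<lambda>j. g j - of_bool (j \<in> S)) (rev [0..<k]))) G =
        G (exponents k (\<lambda>a. e a - of_bool (k - 1 - a \<in> S)))" .
  qed
  \<comment> \<open>Reflecting the subsets undoes the reversed reading order.\<close>
  also have "\<dots> = (\<Sum>S | S \<subseteq> {..<k} \<and> card S = i. G (exponents k (\<lambda>a. e a - of_bool (a \<in> S))))"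
  proof (rule sum.reindex_bij_witness[where i = "\<lambda>S. (\<lambda>j. k - 1 - j) ` S" and j = "\<lambda>S. (\<lambda>j. k - 1 - j) ` S"])
    fix S assume S: "S \<in> {S. S \<subseteq> {..<k} \<and> card S = i}"
    then have "(\<lambda>j. k - 1 - j) ` (\<lambda>j. k - 1 - j) ` S = (\<lambda>j. j) ` S"
      unfolding image_image by (intro image_cong) auto
    then show "(\<lambda>j. k - 1 - j) ` (\<lambda>j. k - 1 - j) ` S = S" by simp
    then show "(\<lambda>j. k - 1 - j) ` (\<lambda>j. k - 1 - j) ` S = S" .
    have "inj_on (\<lambda>j. k - 1 - j) S"
    proof (rule inj_onI)
      fix x y assume *: "x \<in> S" "y \<in> S" and eq: "k - 1 - x = k - 1 - y"
      from S * have "x < k" "y < k" by auto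
      with eq show "x = y" by linarith
    qed
    with S show "(\<lambda>j. k - 1 - j) ` S \<in> {S. S \<subseteq> {..<k} \<and> card S = i}"
      by (auto simp: card_image subset_iff)
    then show "(\<lambda>j. k - 1 - j) ` S \<in> {S. S \<subseteq> {..<k} \<and> card S = i}" .
    have "a \<in> (\<lambda>j. k - 1 - j) ` S \<longleftrightarrow> k - 1 - a \<in> S" if "a < k" for a
    proof
      assume "k - 1 - a \<in> S"
      then have "k - 1 - (k - 1 - a) \<in> (\<lambda>j. k - 1 - j) ` S" by blast
      then show "a \<in> (\<lambda>j. k - 1 - j) ` S" using that by simp
    qed (use S that in auto)
    then show "G (exponents k (\<lambda>a. e a - of_bool (a \<in> (\<lambda>j. k - 1 - j) ` S))) =
        G (exponents k (\<lambda>a. e a - of_bool (k - 1 - a \<in> S)))"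
      by (intro arg_cong[where f = G] exponents_cong) simp
  qed
  also have "\<dots> = series_mult (F1 i) G (exponents k e)"
    by (rule series_mult_F1[symmetric]) (rule pos)
  finally show ?thesis
    by (simp add: M_coeff_def monom_of_def exponents_def k_def e_def)
qed

text \<open>The right-hand side has the adjoint property by \<open>pairing_Hlower\<close>, and
  nondegeneracy makes it the only such element, so the definite description is met.\<close>

lemma perp_F1:
  "perp (F1 i) h = (\<Sum>\<alpha>\<in>Poly_Mapping.keys h. const (Poly_Mapping.lookup h \<alpha>) * Hlower i (map int (parts \<alpha>)))"
proof -
  have "pairing (\<Sum>\<alpha>\<in>Poly_Mapping.keys h. const (Poly_Mapping.lookup h \<alpha>) * Hlower i (map int (parts \<alpha>))) G =
      pairing h (series_mult (F1 i) G)" if "G \<in> QSym" for G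
    using that by (simp add: pairing_sum pairing_const pairing_Hlower pairing_def[of h])
  then show ?thesis
    unfolding perp_def by (intro the_equality) (auto intro: pairing_eqI)
qed

section \<open>The operators \<open>B\<close> on words\<close>

definition B_word :: "int \<Rightarrow> int list \<Rightarrow> nsym" where
  "B_word b g = (\<Sum>i\<le>length g. (- 1) ^ i * H (b + int i) * Hlower i g)"

text \<open>No more letters can be lowered than the word has. A common upper bound lets words of
  different lengths be compared.\<close>

lemma B_word_superset:
  assumes "length g \<le> N"
  shows "B_word b g = (\<Sum>i\<le>N. (- 1) ^ i * H (b + int i) * Hlower i g)"
  unfolding B_word_def using assms by (intro sum.mono_neutral_left) (auto simp: Hlower_eq_0)

lemma B_eq: "B b h = (\<Sum>\<alpha>\<in>Poly_Mapping.keys h. const (Poly_Mapping.lookup h \<alpha>) * B_word b (map int (parts \<alpha>)))"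
proof -
  \<comment> \<open>A bound for the lengths of all words in \<open>h\<close> at once; beyond it
    every term of \<open>Sum_any\<close> is zero.\<close>
  define N where "N = (\<Sum>\<alpha>\<in>Poly_Mapping.keys h. length (parts \<alpha>))"
  have N: "length (map int (parts \<alpha>)) \<le> N" if "\<alpha> \<in> Poly_Mapping.keys h" for \<alpha>
    using that by (auto simp: N_def intro: member_le_sum)
  then have "perp (F1 i) h = 0" if "N < i" for i
  proof -
    have "Hlower i (map int (parts \<alpha>)) = 0" if "\<alpha> \<in> Poly_Mapping.keys h" for \<alpha>
      using N[OF that] \<open>N < i\<close> by (intro Hlower_eq_0) simp
    then show ?thesis unfolding perp_F1 by (simp add: sum.neutral)
  qed
  then have "{i. (- 1) ^ i * H (b + int i) * perp (F1 i) h \<noteq> 0} \<subseteq> {..N}"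
    by (auto simp: not_less[symmetric])
  then have "B b h = (\<Sum>i\<le>N. (- 1) ^ i * H (b + int i) * perp (F1 i) h)"
    unfolding B_def by (intro Sum_any.expand_superset) auto
  also have "\<dots> = (\<Sum>i\<le>N. \<Sum>\<alpha>\<in>Poly_Mapping.keys h. const (Poly_Mapping.lookup h \<alpha>) *
      ((- 1) ^ i * H (b + int i) * Hlower i (map int (parts \<alpha>))))"
    unfolding perp_F1 sum_distrib_left
    by (intro sum.cong refl) (metis const_mult_commute mult.assoc)
  also have "\<dots> = (\<Sum>\<alpha>\<in>Poly_Mapping.keys h. const (Poly_Mapping.lookup h \<alpha>) * B_word b (map int (parts \<alpha>)))"
    by (subst sum.swap) (simp add: B_word_superset[OF N] sum_distrib_left)
  finally show ?thesis .
qed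

lemma B_add: "B b (h + k) = B b h + B b k"
  unfolding B_eq by (rule setsum_keys_plus_distrib) (simp_all add: single_add algebra_simps)

lemma B_zero [simp]: "B b 0 = 0"
  by (simp add: B_eq)

lemma B_sum: "B b (\<Sum>i\<in>I. h i) = (\<Sum>i\<in>I. B b (h i))"
  by (induction I rule: infinite_finite_induct) (simp_all add: B_add)

lemma B_single: "B b (Poly_Mapping.single \<alpha> c) = const c * B_word b (map int (parts \<alpha>))"
  by (simp add: B_eq)

lemma const_mult_single: "const c * Poly_Mapping.single \<alpha> d = Poly_Mapping.single \<alpha> (c * d)"
  by (simp add: mult_single)

text \<open>Removing zero letters changes neither \<open>Hprod\<close> nor \<open>Hlower\<close>,
  and a negative letter makes both vanish. Hence \<open>B_word\<close> computes \<open>B\<close> on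
  all integer words.\<close>

lemma B_Hprod: "B b (const c * Hprod g) = const c * B_word b g"
proof (cases "\<exists>r\<in>set g. r < 0")
  case True
  then have "Hprod g = 0" "Hlower i g = 0" for i
    by (simp_all add: Hprod_eq Hlower_normalize[of _ g])
  then show ?thesis by (simp add: B_word_def)
next
  case False
  define f where "f = filter (\<lambda>a. 0 < a) (map nat g)"
  have parts: "parts (Composition f) = f"
    by (rule parts_Composition) (auto simp: f_def)
  have "Hprod g = Poly_Mapping.single (Composition f) 1"
    using False by (simp add: Hprod_eq f_def)
  then have "B b (const c * Hprod g) = const c * B_word b (map int f)"
    by (simp add: const_mult_single B_single parts)
  also have "Hlower i (map int f) = Hlower i g" for i
    using False by (simp add: Hlower_normalize[of i g] f_def)
  then have "B_word b (map int f) = B_word b g"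
    by (subst (1 2) B_word_superset[of _ "length g"]) (auto simp: f_def intro: order.trans[OF length_filter_le])
  finally show ?thesis .
qed

text \<open>Grouped by cardinality: what the letters in \<open>S\<close> lose in total is gained by
  the leading letter.\<close>

lemma B_word_subsets:
  "B_word b (map g (rev [0..<m])) = (\<Sum>S\<in>Pow {..<m}. (- 1) ^ card S *
     Hprod ((b + int (card S)) # map (\<lambda>j. g j - of_bool (j \<in> S)) (rev [0..<m])))"
proof -
  let ?f = "\<lambda>S. (- 1) ^ card S * Hprod ((b + int (card S)) # map (\<lambda>j. g j - of_bool (j \<in> S)) (rev [0..<m]))"
  have "B_word b (map g (rev [0..<m])) = (\<Sum>i\<le>m. \<Sum>S | S \<subseteq> {..<m} \<and> card S = i. ?f S)"
    unfolding B_word_def Hlower_subsets sum_distrib_left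
    by (intro sum.cong) (auto simp: mult.assoc)
  also have "\<dots> = (\<Sum>S\<in>Pow {..<m}. ?f S)"
  proof -
    have "card ` Pow {..<m} \<subseteq> {..m}"
      using card_mono[of "{..<m}"] by fastforce
    from sum.group[OF _ _ this, of ?f] show ?thesis by simp
  qed
  finally show ?thesis .
qed

section \<open>Generating functions for the immaculate basis\<close>

type_synonym laurent = "(nat \<Rightarrow>\<^sub>0 int) \<Rightarrow>\<^sub>0 rat"

text \<open>Letters are read from the variable \<open>m - 1\<close> down to \<open>0\<close>, so that prepending a letter adds the
  variable \<open>m\<close> and leaves the others in place.\<close>

definition laurent_word :: "nat \<Rightarrow> laurent \<Rightarrow> nsym" where
  "laurent_word m f = (\<Sum>g\<in>Poly_Mapping.keys f. const (Poly_Mapping.lookup f g) *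
     Hprod (map (Poly_Mapping.lookup g) (rev [0..<m])))"

lemma laurent_word_add: "laurent_word m (f + f') = laurent_word m f + laurent_word m f'"
  unfolding laurent_word_def by (rule setsum_keys_plus_distrib) (simp_all add: single_add algebra_simps)

lemma laurent_word_zero [simp]: "laurent_word m 0 = 0"
  by (simp add: laurent_word_def)

lemma laurent_word_sum: "laurent_word m (\<Sum>i\<in>I. f i) = (\<Sum>i\<in>I. laurent_word m (f i))"
  by (induction I rule: infinite_finite_induct) (simp_all add: laurent_word_add)

lemma laurent_word_single: "laurent_word m (Poly_Mapping.single g c) = const c * Hprod (map (Poly_Mapping.lookup g) (rev [0..<m]))"
  by (simp add: laurent_word_def)

text \<open>\<open>laurent_word m\<close> does not see the exponents of the variables from
  \<open>m\<close> on, so these must be absent before \<open>m\<close> becomes the leading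
  variable.\<close>

definition laurent_below :: "nat \<Rightarrow> laurent set" where
  "laurent_below m = {f. \<forall>g\<in>Poly_Mapping.keys f. \<forall>j\<ge>m. Poly_Mapping.lookup g j = 0}"

lemma laurent_below_mult:
  assumes "f \<in> laurent_below m" "f' \<in> laurent_below m"
  shows "f * f' \<in> laurent_below m"
proof -
  have "\<exists>a\<in>Poly_Mapping.keys f. \<exists>b\<in>Poly_Mapping.keys f'. g = a + b" if "g \<in> Poly_Mapping.keys (f * f')" for g
    using that keys_mult[of f f'] by blast
  then show ?thesis
    using assms by (fastforce simp: laurent_below_def lookup_add)
qed

lemma laurent_below_diff:
  assumes "f \<in> laurent_below m" "f' \<in> laurent_below m"
  shows "f - f' \<in> laurent_below m"
proof -
  have "Poly_Mapping.keys (f - f') \<subseteq> Poly_Mapping.keys f \<union> Poly_Mapping.keys f'"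
    by (auto simp: in_keys_iff lookup_minus)
  then show ?thesis
    using assms by (auto simp: laurent_below_def)
qed

lemma laurent_below_single:
  "(\<And>j. m \<le> j \<Longrightarrow> Poly_Mapping.lookup g j = 0) \<Longrightarrow> Poly_Mapping.single g c \<in> laurent_below m"
  by (simp add: laurent_below_def)

lemma laurent_below_one: "1 \<in> laurent_below m"
  by (simp add: laurent_below_def)

lemma laurent_below_prod:
  "(\<And>i. i \<in> I \<Longrightarrow> f i \<in> laurent_below m) \<Longrightarrow> (\<Prod>i\<in>I. f i) \<in> laurent_below m"
  by (induction I rule: infinite_finite_induct) (auto simp: laurent_below_one laurent_below_mult)

lemma prod_single:
  "(\<Prod>i\<in>I. Poly_Mapping.single (a i) (c i)) =
    (Poly_Mapping.single (\<Sum>i\<in>I. a i) (\<Prod>i\<in>I. c i) :: 'b::comm_monoid_add \<Rightarrow>\<^sub>0 'c::comm_semiring_1)"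
  by (induction I rule: infinite_finite_induct) (simp_all add: mult_single)

abbreviation mvar :: "nat \<Rightarrow> int \<Rightarrow> nat \<Rightarrow>\<^sub>0 int" where
  "mvar \<equiv> Poly_Mapping.single"

lemma const_neg1_power: "const ((- 1) ^ n) = (- 1) ^ n"
proof (induction n)
  case (Suc n)
  have "const ((- 1) ^ Suc n) = const (- 1) * const ((- 1) ^ n)"
    by (simp add: mult_single del: single_uminus)
  then show ?case using Suc by (simp add: single_uminus)
qed simp

text \<open>Expanding the product over subsets \<open>S\<close>, each chosen term
  \<open>- x_m / x_j\<close> contributes a sign, lowers letter \<open>j\<close> and raises the
  leading letter, exactly as in \<open>B_word_subsets\<close>.\<close>

lemma B_laurent_word:
  assumes "f \<in> laurent_below m"
  shows "B b (laurent_word m f) = laurent_word (Suc m) (f * Poly_Mapping.single (mvar m b) 1 *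
    (\<Prod>j<m. 1 - Poly_Mapping.single (mvar m 1 - mvar j 1) 1))"
proof -
  define u where "u S = (\<Sum>j\<in>S. mvar m 1 - mvar j 1)" for S
  have "(\<Prod>j<m. 1 - Poly_Mapping.single (mvar m 1 - mvar j 1) 1) =
      (\<Prod>j<m. Poly_Mapping.single (mvar m 1 - mvar j 1) (- 1) + 1 :: laurent)"
    by (simp add: single_uminus)
  also have "\<dots> = (\<Sum>S\<in>Pow {..<m}. Poly_Mapping.single (u S) ((- 1) ^ card S))"
    by (subst prod_add) (simp_all add: prod_single u_def)
  finally have prod: "(\<Prod>j<m. 1 - Poly_Mapping.single (mvar m 1 - mvar j 1) 1) =
      (\<Sum>S\<in>Pow {..<m}. Poly_Mapping.single (u S) ((- 1) ^ card S) :: laurent)" .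
  have lu: "Poly_Mapping.lookup (u S) v = (if v = m then int (card S) else - of_bool (v \<in> S))"
    if S: "S \<subseteq> {..<m}" for S v
  proof -
    have fin: "finite S" using S finite_subset by blast
    have "Poly_Mapping.lookup (u S) v =
      (\<Sum>j\<in>S. (if v = m then 1 else 0)) - (\<Sum>j\<in>S. if j = v then 1 else 0)"
      unfolding u_def lookup_sum sum_subtractf[symmetric]
      by (intro sum.cong) (auto simp: lookup_minus lookup_single when_def)
    then show ?thesis using S fin by auto
  qed
  have step: "B b (laurent_word m (Poly_Mapping.single g c)) = laurent_word (Suc m) (Poly_Mapping.single g c *
      Poly_Mapping.single (mvar m b) 1 * (\<Sum>S\<in>Pow {..<m}. Poly_Mapping.single (u S) ((- 1) ^ card S)))"
    if g: "\<And>j. m \<le> j \<Longrightarrow> Poly_Mapping.lookup g j = 0" for g c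
  proof -
    have "B b (laurent_word m (Poly_Mapping.single g c)) = (\<Sum>S\<in>Pow {..<m}. const c * ((- 1) ^ card S *
        Hprod ((b + int (card S)) # map (\<lambda>j. Poly_Mapping.lookup g j - of_bool (j \<in> S)) (rev [0..<m]))))"
      unfolding laurent_word_single B_Hprod B_word_subsets sum_distrib_left ..
    also have "\<dots> = (\<Sum>S\<in>Pow {..<m}. laurent_word (Suc m) (Poly_Mapping.single (g + mvar m b + u S) (c * (- 1) ^ card S)))"
    proof (rule sum.cong[OF refl])
      fix S assume "S \<in> Pow {..<m}"
      then have S: "S \<subseteq> {..<m}" by simp
      have "map (Poly_Mapping.lookup (g + mvar m b + u S)) (rev [0..<Suc m]) =
          (b + int (card S)) # map (\<lambda>j. Poly_Mapping.lookup g j - of_bool (j \<in> S)) (rev [0..<m])"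
        using g[of m] by (auto simp: lookup_add lu[OF S] lookup_single)
      moreover have "const (c * (- 1) ^ card S) = const c * ((- 1) ^ card S :: nsym)"
        by (simp add: mult_single flip: const_neg1_power)
      ultimately show "const c * ((- 1) ^ card S *
        Hprod ((b + int (card S)) # map (\<lambda>j. Poly_Mapping.lookup g j - of_bool (j \<in> S)) (rev [0..<m]))) =
        laurent_word (Suc m) (Poly_Mapping.single (g + mvar m b + u S) (c * (- 1) ^ card S))"
        by (simp only: laurent_word_single mult.assoc)
    qed
    finally show ?thesis
      by (simp add: laurent_word_sum sum_distrib_left mult_single)
  qed
  have "B b (laurent_word m f) = (\<Sum>g\<in>Poly_Mapping.keys f. B b (laurent_word m (Poly_Mapping.single g (Poly_Mapping.lookup f g))))"
    by (subst poly_mapping_expand[of f]) (simp add: laurent_word_sum B_sum)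
  also have "\<dots> = (\<Sum>g\<in>Poly_Mapping.keys f. laurent_word (Suc m) (Poly_Mapping.single g (Poly_Mapping.lookup f g) *
      Poly_Mapping.single (mvar m b) 1 * (\<Sum>S\<in>Pow {..<m}. Poly_Mapping.single (u S) ((- 1) ^ card S))))"
    using assms by (intro sum.cong refl step) (auto simp: laurent_below_def)
  also have "\<dots> = laurent_word (Suc m) ((\<Sum>g\<in>Poly_Mapping.keys f. Poly_Mapping.single g (Poly_Mapping.lookup f g)) *
      Poly_Mapping.single (mvar m b) 1 * (\<Sum>S\<in>Pow {..<m}. Poly_Mapping.single (u S) ((- 1) ^ card S)))"
    by (simp only: laurent_word_sum sum_distrib_right)
  finally show ?thesis
    unfolding prod poly_mapping_expand[symmetric] .
qed

text \<open>Variables are numbered from the last letter backwards, so the variable of the earlier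
  letter, in the numerator, is the one with the larger index.\<close>

definition immaculate_gf :: "nat list \<Rightarrow> laurent" where
  "immaculate_gf bs = Poly_Mapping.single (\<Sum>j<length bs. mvar j (int (bs ! (length bs - 1 - j)))) 1 *
     (\<Prod>j<length bs. \<Prod>i<j. 1 - Poly_Mapping.single (mvar j 1 - mvar i 1) 1)"

lemma immaculate_gf_below: "immaculate_gf bs \<in> laurent_below (length bs)"
  unfolding immaculate_gf_def
  by (intro laurent_below_mult laurent_below_prod laurent_below_diff laurent_below_one laurent_below_single)
     (auto simp: lookup_sum lookup_minus lookup_single when_def intro!: sum.neutral)

lemma foldr_B_eq_laurent_word: "foldr (\<lambda>m. B (int m)) bs 1 = laurent_word (length bs) (immaculate_gf bs)"
proof (induction bs)
  case Nil
  show ?case by (simp add: immaculate_gf_def laurent_word_def)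
next
  case (Cons b bs)
  have e: "(\<Sum>j<length bs. mvar j (int ((b # bs) ! (length bs - j)))) =
      (\<Sum>j<length bs. mvar j (int (bs ! (length bs - 1 - j))))"
    by (intro sum.cong) (auto simp: nth_Cons' )
  have se: "Poly_Mapping.single (g + h) 1 = (Poly_Mapping.single g 1 * Poly_Mapping.single h 1 :: laurent)" for g h
    by (simp add: mult_single)
  have "immaculate_gf bs * Poly_Mapping.single (mvar (length bs) (int b)) 1 *
      (\<Prod>j<length bs. 1 - Poly_Mapping.single (mvar (length bs) 1 - mvar j 1) 1) = immaculate_gf (b # bs)"
    by (simp add: immaculate_gf_def e se mult_ac)
  then show ?case
    using B_laurent_word[OF immaculate_gf_below, of "int b" bs] Cons by simp
qed

section \<open>The dual immaculate basis\<close>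

text \<open>The sum \<open>0 \<gamma>\<^sub>1 + 1 \<gamma>\<^sub>2 + 2 \<gamma>\<^sub>3 + \<cdots>\<close>. The operators \<open>B\<close> move size from later letters to the
  first one, which lowers it; this makes the immaculate functions unitriangular in the words.\<close>

fun position_weight :: "nat list \<Rightarrow> nat" where
  "position_weight [] = 0"
| "position_weight (r # g) = position_weight g + sum_list g"

text \<open>The homogeneous elements of size \<open>s\<close> that may stand as error terms beside a
  leading word of weight \<open>n\<close>.\<close>

definition lower :: "nat \<Rightarrow> nat \<Rightarrow> nsym \<Rightarrow> bool" where
  "lower s n h \<longleftrightarrow> (\<forall>\<gamma>\<in>Poly_Mapping.keys h. sum_list (parts \<gamma>) = s \<and> position_weight (parts \<gamma>) < n)"

lemma lower_zero [simp]: "lower s n 0"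
  by (simp add: lower_def)

lemma lower_add: "lower s n h \<Longrightarrow> lower s n k \<Longrightarrow> lower s n (h + k)"
  using keys_add[of h k] by (auto simp: lower_def)

lemma lower_sum: "(\<And>i. i \<in> I \<Longrightarrow> lower s n (f i)) \<Longrightarrow> lower s n (\<Sum>i\<in>I. f i)"
  by (induction I rule: infinite_finite_induct) (auto intro: lower_add)

lemma lower_const_mult: "lower s n h \<Longrightarrow> lower s n (const c * h)"
  by (auto simp: lower_def in_keys_iff lookup_const_mult)

lemma lower_mono: "lower s n h \<Longrightarrow> n \<le> n' \<Longrightarrow> lower s n' h"
  by (fastforce simp: lower_def)

text \<open>A positive letter pushes the rest of the word one place to the right, which adds the
  size of the rest to the weight. \<open>H 0\<close> pushes nothing, hence only an
  inequality.\<close>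

lemma keys_H_mult:
  assumes "\<gamma> \<in> Poly_Mapping.keys (H b * h)"
  shows "0 \<le> b \<and> (\<exists>\<gamma>'\<in>Poly_Mapping.keys h. sum_list (parts \<gamma>) = nat b + sum_list (parts \<gamma>') \<and>
    position_weight (parts \<gamma>) \<le> position_weight (parts \<gamma>') + sum_list (parts \<gamma>'))"
proof (cases b "0 :: int" rule: linorder_cases)
  case greater
  then have p: "parts (Composition [nat b]) = [nat b]"
    by (intro parts_Composition) auto
  obtain \<gamma>' where "\<gamma>' \<in> Poly_Mapping.keys h" "\<gamma> = Composition [nat b] + \<gamma>'"
    using keys_mult[of "H b" h] greater assms by (auto simp: H_def)
  then show ?thesis
    using p greater by (auto intro!: bexI[of _ \<gamma>'])
qed (use assms in \<open>auto simp: H_def\<close>)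

lemma keys_Hlower:
  "\<gamma> \<in> Poly_Mapping.keys (Hlower i (map int g)) \<Longrightarrow>
    sum_list (parts \<gamma>) + i = sum_list g \<and> position_weight (parts \<gamma>) \<le> position_weight g"
proof (induction g arbitrary: i \<gamma>)
  case Nil
  then show ?case by (cases i) auto
next
  case (Cons r g)
  have *: "sum_list (parts \<gamma>) + i' = nat b + sum_list g \<and> position_weight (parts \<gamma>) \<le> position_weight g + sum_list g \<and> 0 \<le> b"
    if key: "\<gamma> \<in> Poly_Mapping.keys (H b * Hlower i' (map int g))" for b i'
  proof -
    obtain \<gamma>' where "0 \<le> b" "\<gamma>' \<in> Poly_Mapping.keys (Hlower i' (map int g))"
      "sum_list (parts \<gamma>) = nat b + sum_list (parts \<gamma>')"
      "position_weight (parts \<gamma>) \<le> position_weight (parts \<gamma>') + sum_list (parts \<gamma>')"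
      using keys_H_mult[OF key] by blast
    with Cons.IH[of \<gamma>' i'] show ?thesis by linarith
  qed
  show ?case
  proof (cases i)
    case 0
    then show ?thesis using Cons.prems *[of "int r" 0] by simp
  next
    case (Suc i')
    then have "\<gamma> \<in> Poly_Mapping.keys (H (int r) * Hlower (Suc i') (map int g)) \<or>
        \<gamma> \<in> Poly_Mapping.keys (H (int r - 1) * Hlower i' (map int g))"
      using Cons.prems keys_add[of "H (int r) * Hlower (Suc i') (map int g)" "H (int r - 1) * Hlower i' (map int g)"]
      by auto
    then show ?thesis
      using *[of "int r" "Suc i'"] *[of "int r - 1" i'] Suc by auto
  qed
qed

text \<open>The term \<open>i = 0\<close> is the leading word. For \<open>i \<ge> 1\<close> the tail
  has lost size \<open>i\<close> and has no larger weight, so prepending a letter yields a weight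
  smaller by at least \<open>i\<close>.\<close>

lemma B_word_leading:
  assumes b: "0 < b" and g: "\<forall>r\<in>set g. 0 < r"
  shows "lower (b + sum_list g) (position_weight (b # g))
    (B_word (int b) (map int g) - Poly_Mapping.single (Composition (b # g)) 1)"
proof -
  have "parts (Composition (b # g)) = b # g"
    using assms by (intro parts_Composition) auto
  then have lead: "H (int b) * Hlower 0 (map int g) = Poly_Mapping.single (Composition (b # g)) 1"
    using Hprod_parts[of "Composition (b # g)"] by (simp add: Hlower_0)
  have "B_word (int b) (map int g) = Poly_Mapping.single (Composition (b # g)) 1 +
      (\<Sum>i\<in>{1..length g}. (- 1) ^ i * H (int b + int i) * Hlower i (map int g))"
    unfolding B_word_def atMost_atLeast0
    by (subst sum.atLeast_Suc_atMost) (auto simp: lead)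
  moreover have "lower (b + sum_list g) (position_weight (b # g))
      (\<Sum>i\<in>{1..length g}. (- 1) ^ i * H (int b + int i) * Hlower i (map int g))"
  proof (rule lower_sum)
    fix i assume i: "i \<in> {1..length g}"
    have "lower (b + sum_list g) (position_weight (b # g)) (H (int b + int i) * Hlower i (map int g))"
      unfolding lower_def
    proof
      fix \<gamma> assume "\<gamma> \<in> Poly_Mapping.keys (H (int b + int i) * Hlower i (map int g))"
      then obtain \<gamma>' where "\<gamma>' \<in> Poly_Mapping.keys (Hlower i (map int g))"
        "sum_list (parts \<gamma>) = nat (int b + int i) + sum_list (parts \<gamma>')"
        "position_weight (parts \<gamma>) \<le> position_weight (parts \<gamma>') + sum_list (parts \<gamma>')"
        using keys_H_mult by blast
      with keys_Hlower[of \<gamma>' i g] i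
      show "sum_list (parts \<gamma>) = b + sum_list g \<and> position_weight (parts \<gamma>) < position_weight (b # g)"
        by auto
    qed
    then show "lower (b + sum_list g) (position_weight (b # g)) ((- 1) ^ i * H (int b + int i) * Hlower i (map int g))"
      by (simp only: const_neg1_power[symmetric] mult.assoc lower_const_mult)
  qed
  ultimately show ?thesis by simp
qed

lemma lower_B_word:
  assumes "0 < b"
  shows "lower (b + sum_list (parts \<gamma>)) (Suc (position_weight (parts \<gamma>) + sum_list (parts \<gamma>)))
    (B_word (int b) (map int (parts \<gamma>)))"
proof -
  have "parts (Composition (b # parts \<gamma>)) = b # parts \<gamma>"
    using assms by (intro parts_Composition) (auto dest: parts_pos)
  then have "lower (b + sum_list (parts \<gamma>)) (Suc (position_weight (parts \<gamma>) + sum_list (parts \<gamma>)))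
      (Poly_Mapping.single (Composition (b # parts \<gamma>)) 1)"
    by (simp add: lower_def)
  moreover have "lower (b + sum_list (parts \<gamma>)) (Suc (position_weight (parts \<gamma>) + sum_list (parts \<gamma>)))
    (B_word (int b) (map int (parts \<gamma>)) - Poly_Mapping.single (Composition (b # parts \<gamma>)) 1)"
    by (rule lower_mono[OF B_word_leading[OF assms]]) (auto dest: parts_pos)
  ultimately show ?thesis
    by (metis (no_types, lifting) add.commute diff_add_cancel lower_add)
qed

text \<open>All words of the error term have the same size as the leading word. \<open>B\<close>
  therefore raises their weight bounds by the same amount and keeps them below it.\<close>

lemma foldr_B_leading:
  assumes "\<forall>b\<in>set bs. 0 < b"
  shows "lower (sum_list bs) (position_weight bs) (foldr (\<lambda>m. B (int m)) bs 1 - Poly_Mapping.single (Composition bs) 1)"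
  using assms
proof (induction bs)
  case Nil
  show ?case by (simp flip: zero_composition_def)
next
  case (Cons b bs)
  define h where "h = foldr (\<lambda>m. B (int m)) bs 1 - Poly_Mapping.single (Composition bs) 1"
  have h: "lower (sum_list bs) (position_weight bs) h"
    using Cons by (simp add: h_def)
  have p: "parts (Composition bs) = bs"
    using Cons.prems by (intro parts_Composition) auto
  have "foldr (\<lambda>m. B (int m)) (b # bs) 1 = B (int b) (Poly_Mapping.single (Composition bs) 1 + h)"
    by (simp add: h_def)
  also have "\<dots> = B_word (int b) (map int bs) + B (int b) h"
    by (simp add: B_add B_single p)
  finally have "foldr (\<lambda>m. B (int m)) (b # bs) 1 - Poly_Mapping.single (Composition (b # bs)) 1 =
      (B_word (int b) (map int bs) - Poly_Mapping.single (Composition (b # bs)) 1) + B (int b) h"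
    by simp
  moreover have "lower (sum_list (b # bs)) (position_weight (b # bs)) (B (int b) h)"
    unfolding B_eq
  proof (intro lower_sum lower_const_mult)
    fix \<gamma> assume "\<gamma> \<in> Poly_Mapping.keys h"
    then have "sum_list (parts \<gamma>) = sum_list bs" "position_weight (parts \<gamma>) < position_weight bs"
      using h by (auto simp: lower_def)
    then show "lower (sum_list (b # bs)) (position_weight (b # bs)) (B_word (int b) (map int (parts \<gamma>)))"
      using lower_B_word[of b \<gamma>] Cons.prems by (auto intro: lower_mono)
  qed
  moreover have "lower (sum_list (b # bs)) (position_weight (b # bs))
      (B_word (int b) (map int bs) - Poly_Mapping.single (Composition (b # bs)) 1)"
    using B_word_leading[of b bs] Cons.prems by simp
  ultimately show ?case by (metis lower_add)
qed

section \<open>Existence and uniqueness of the dual basis\<close>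

definition immaculate_rest :: "composition \<Rightarrow> nsym" where
  "immaculate_rest \<beta> = immaculate \<beta> - Poly_Mapping.single \<beta> 1"

lemma lower_immaculate_rest: "lower (sum_list (parts \<beta>)) (position_weight (parts \<beta>)) (immaculate_rest \<beta>)"
  using foldr_B_leading[of "parts \<beta>"]
  by (auto simp: immaculate_rest_def immaculate_def parts_inverse dest: parts_pos)

lemma pairing_immaculate:
  "pairing (immaculate \<beta>) F = M_coeff \<beta> F +
    (\<Sum>\<gamma>\<in>Poly_Mapping.keys (immaculate_rest \<beta>). Poly_Mapping.lookup (immaculate_rest \<beta>) \<gamma> * M_coeff \<gamma> F)"
proof -
  have "immaculate \<beta> = Poly_Mapping.single \<beta> 1 + immaculate_rest \<beta>"
    by (simp add: immaculate_rest_def)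
  then show ?thesis
    by (simp add: pairing_add pairing_def[of "immaculate_rest \<beta>"])
qed

text \<open>The pairings determine the monomial coordinates one after another, by unitriangularity
  and induction on the weight.\<close>

lemma QSym_eqI_immaculate:
  assumes "F \<in> QSym" "G \<in> QSym" "\<And>\<beta>. pairing (immaculate \<beta>) F = pairing (immaculate \<beta>) G"
  shows "F = G"
proof (rule QSym_eqI[OF assms(1,2)])
  fix \<beta>
  show "M_coeff \<beta> F = M_coeff \<beta> G"
  proof (induction "position_weight (parts \<beta>)" arbitrary: \<beta> rule: less_induct)
    case less
    have "(\<Sum>\<gamma>\<in>Poly_Mapping.keys (immaculate_rest \<beta>). Poly_Mapping.lookup (immaculate_rest \<beta>) \<gamma> * M_coeff \<gamma> F) =
        (\<Sum>\<gamma>\<in>Poly_Mapping.keys (immaculate_rest \<beta>). Poly_Mapping.lookup (immaculate_rest \<beta>) \<gamma> * M_coeff \<gamma> G)"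
      using less lower_immaculate_rest[of \<beta>] by (intro sum.cong) (auto simp: lower_def)
    then show ?case
      using assms(3)[of \<beta>] by (simp add: pairing_immaculate)
  qed
qed

text \<open>The monomial coordinates of a dual immaculate function, found by forward substitution in
  the unitriangular system; it terminates because the remaining words have smaller weight.\<close>

function dual_coeff :: "composition \<Rightarrow> composition \<Rightarrow> rat" where
  "dual_coeff \<alpha> \<beta> = (if \<alpha> = \<beta> then 1 else 0) -
    (\<Sum>\<gamma>\<in>Poly_Mapping.keys (immaculate_rest \<beta>). Poly_Mapping.lookup (immaculate_rest \<beta>) \<gamma> * dual_coeff \<alpha> \<gamma>)"
  by pat_completeness auto
termination
  by (relation "measure (\<lambda>(\<alpha>, \<beta>). position_weight (parts \<beta>))") (use lower_immaculate_rest in \<open>auto simp: lower_def\<close>)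

declare dual_coeff.simps [simp del]

text \<open>Immaculate functions are homogeneous, so the substitution never leaves the size of
  \<open>\<alpha>\<close>. This provides the degree bound that \<open>QSym\<close> asks for.\<close>

lemma dual_coeff_nonzero: "dual_coeff \<alpha> \<beta> \<noteq> 0 \<Longrightarrow> sum_list (parts \<beta>) = sum_list (parts \<alpha>)"
proof (induction "position_weight (parts \<beta>)" arbitrary: \<beta> rule: less_induct)
  case less
  show ?case
  proof (rule ccontr)
    assume *: "sum_list (parts \<beta>) \<noteq> sum_list (parts \<alpha>)"
    have "dual_coeff \<alpha> \<gamma> = 0" if "\<gamma> \<in> Poly_Mapping.keys (immaculate_rest \<beta>)" for \<gamma>
      using less(1)[of \<gamma>] that lower_immaculate_rest[of \<beta>] * by (auto simp: lower_def)
    then have "dual_coeff \<alpha> \<beta> = 0"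
      using * by (subst dual_coeff.simps) auto
    with less.prems show False ..
  qed
qed

text \<open>The series with coordinates \<open>dual_coeff \<alpha>\<close> is a witness and
  \<open>QSym_eqI_immaculate\<close> gives uniqueness, so the definite description denotes.\<close>

lemma dual_immaculate_QSym: "dual_immaculate \<alpha> \<in> QSym"
  and pairing_dual_immaculate: "pairing (immaculate \<beta>) (dual_immaculate \<alpha>) = (if \<alpha> = \<beta> then 1 else 0)"
proof -
  let ?P = "\<lambda>F. F \<in> QSym \<and> (\<forall>\<beta>. pairing (immaculate \<beta>) F = (if \<alpha> = \<beta> then 1 else 0))"
  have "(\<lambda>x. dual_coeff \<alpha> (exponent_composition x)) \<in> QSym"
    by (rule of_coeff_QSym[of _ "sum_list (parts \<alpha>)"]) (simp add: dual_coeff_nonzero)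
  moreover have "pairing (immaculate \<beta>) (\<lambda>x. dual_coeff \<alpha> (exponent_composition x)) = (if \<alpha> = \<beta> then 1 else 0)" for \<beta>
    unfolding pairing_immaculate M_coeff_of_coeff by (subst dual_coeff.simps) simp
  ultimately have "?P (\<lambda>x. dual_coeff \<alpha> (exponent_composition x))" by blast
  then have "\<exists>!F. ?P F"
    by (intro ex1I[of ?P]) (auto intro: QSym_eqI_immaculate)
  from theI'[OF this] show "dual_immaculate \<alpha> \<in> QSym"
    "pairing (immaculate \<beta>) (dual_immaculate \<alpha>) = (if \<alpha> = \<beta> then 1 else 0)"
    unfolding dual_immaculate_def by blast+
qed

section \<open>Pairing with Schur functions\<close>

lemma lookup_content: "Poly_Mapping.lookup (Defs.content la T) v = card {c \<in> cells la. T c = v}"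
proof -
  have "Poly_Mapping.lookup (Defs.content la T) v = (\<Sum>c\<in>cells la. if T c = v then 1 else 0)"
    unfolding Defs.content_def lookup_sum by (intro sum.cong) (auto simp: lookup_single when_def)
  then show ?thesis by (simp add: sum.If_cases Collect_conj_eq)
qed

lemma entry_in_keys_content: "c \<in> cells la \<Longrightarrow> T c \<in> Poly_Mapping.keys (Defs.content la T)"
  by (cases c) (auto simp: in_keys_iff lookup_content card_eq_0_iff)

lemma mdeg_content: "mdeg (Defs.content la T) = card (cells la)"
proof -
  have "mdeg (Defs.content la T) = (\<Sum>v\<in>Poly_Mapping.keys (Defs.content la T). \<Sum>c\<in>{c \<in> cells la. T c = v}. 1)"
    by (simp add: mdeg_def lookup_content)
  also have "\<dots> = (\<Sum>c\<in>cells la. 1)"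
    by (rule sum.group) (auto simp: entry_in_keys_content)
  finally show ?thesis by simp
qed

text \<open>The variables of \<open>x\<close> and \<open>y\<close> are matched by rank: the smallest
  with the smallest, and so on.\<close>

lemma exponent_composition_eq_relabel:
  assumes "exponent_composition x = exponent_composition y"
  obtains \<phi> where "bij_betw \<phi> (Poly_Mapping.keys x) (Poly_Mapping.keys y)"
    "strict_mono_on (Poly_Mapping.keys x) \<phi>"
    "\<And>v. v \<in> Poly_Mapping.keys x \<Longrightarrow> Poly_Mapping.lookup y (\<phi> v) = Poly_Mapping.lookup x v"
proof -
  define xs where "xs = sorted_list_of_set (Poly_Mapping.keys x)"
  define ys where "ys = sorted_list_of_set (Poly_Mapping.keys y)"
  have xs: "sorted_wrt (<) xs" "distinct xs" "set xs = Poly_Mapping.keys x"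
    and ys: "sorted_wrt (<) ys" "distinct ys" "set ys = Poly_Mapping.keys y"
    by (simp_all add: xs_def ys_def)
  have eq: "map (Poly_Mapping.lookup x) xs = map (Poly_Mapping.lookup y) ys"
    using assms by (metis parts_exponent_composition xs_def ys_def)
  then have len: "length xs = length ys" by (rule map_eq_imp_length_eq)
  define ix where "ix = inv_into {..<length xs} ((!) xs)"
  have bx: "bij_betw ((!) xs) {..<length xs} (Poly_Mapping.keys x)"
    using xs by (intro bij_betw_nth) auto
  have bi: "bij_betw ix (Poly_Mapping.keys x) {..<length xs}"
    unfolding ix_def by (rule bij_betw_inv_into[OF bx])
  have ixv: "ix v < length xs" "xs ! ix v = v" if "v \<in> Poly_Mapping.keys x" for v
    using bij_betwE[OF bi] that bij_betw_inv_into_right[OF bx that] by (auto simp: ix_def)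
  have "bij_betw ((!) ys) {..<length xs} (Poly_Mapping.keys y)"
    using ys len by (intro bij_betw_nth) auto
  from bij_betw_trans[OF bi this] have 1: "bij_betw (\<lambda>v. ys ! ix v) (Poly_Mapping.keys x) (Poly_Mapping.keys y)"
    by (simp add: o_def)
  have 2: "strict_mono_on (Poly_Mapping.keys x) (\<lambda>v. ys ! ix v)"
  proof (rule strict_mono_onI)
    fix v w assume vw: "v \<in> Poly_Mapping.keys x" "w \<in> Poly_Mapping.keys x" "v < w"
    have "ix v < ix w"
    proof (rule ccontr)
      assume "\<not> ix v < ix w"
      then have "xs ! ix w \<le> xs ! ix v"
        using sorted_wrt_nth_less[OF xs(1), of "ix w" "ix v"] ixv[OF vw(1)]
        by (cases "ix v = ix w") auto
      with ixv vw show False by auto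
    qed
    then show "ys ! ix v < ys ! ix w"
      using sorted_wrt_nth_less[OF ys(1)] ixv[OF vw(2)] len by simp
  qed
  have 3: "Poly_Mapping.lookup y (ys ! ix v) = Poly_Mapping.lookup x v" if "v \<in> Poly_Mapping.keys x" for v
    using arg_cong[OF eq, of "\<lambda>zs. zs ! ix v"] ixv[OF that] len by simp
  from that[OF 1 2 3] show thesis .
qed

lemma finite_ssyt_content: "finite {T \<in> ssyt la. Defs.content la T = x}"
proof (rule finite_subset)
  show "{T \<in> ssyt la. Defs.content la T = x} \<subseteq> Pi\<^sub>E (cells la) (\<lambda>_. Poly_Mapping.keys x)"
    by (auto simp: ssyt_def PiE_def Pi_def entry_in_keys_content)
qed (auto intro: finite_PiE)

text \<open>Relabelling entries by an increasing map preserves semistandardness and carries content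
  \<open>x\<close> to content \<open>y\<close> injectively. Exchanging \<open>x\<close> and
  \<open>y\<close> gives the reverse inequality.\<close>

lemma card_ssyt_content_le:
  assumes "exponent_composition x = exponent_composition y"
  shows "card {T \<in> ssyt la. Defs.content la T = x} \<le> card {T \<in> ssyt la. Defs.content la T = y}"
proof -
  obtain \<phi> where bij: "bij_betw \<phi> (Poly_Mapping.keys x) (Poly_Mapping.keys y)"
    and mono: "strict_mono_on (Poly_Mapping.keys x) \<phi>"
    and lk: "\<And>v. v \<in> Poly_Mapping.keys x \<Longrightarrow> Poly_Mapping.lookup y (\<phi> v) = Poly_Mapping.lookup x v"
    using exponent_composition_eq_relabel[OF assms] by blast
  have inj: "inj_on \<phi> (Poly_Mapping.keys x)" using bij by (rule bij_betw_imp_inj_on)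
  let ?f = "\<lambda>T. restrict (\<phi> \<circ> T) (cells la)"
  show ?thesis
  proof (rule card_inj_on_le[OF _ _ finite_ssyt_content])
    have K: "T c \<in> Poly_Mapping.keys x" if "Defs.content la T = x" "c \<in> cells la" for T c
      using entry_in_keys_content[OF that(2), of T] that(1) by simp
    show "inj_on ?f {T \<in> ssyt la. Defs.content la T = x}"
    proof (rule inj_onI, rule ext)
      fix T U c assume T: "T \<in> {T \<in> ssyt la. Defs.content la T = x}" "U \<in> {T \<in> ssyt la. Defs.content la T = x}"
        and eq: "?f T = ?f U"
      show "T c = U c"
      proof (cases "c \<in> cells la")
        case True
        then have "\<phi> (T c) = \<phi> (U c)" using fun_cong[OF eq, of c] by simp
        moreover have "T c \<in> Poly_Mapping.keys x" "U c \<in> Poly_Mapping.keys x"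
          using K True T by blast+
        ultimately show ?thesis by (rule inj_onD[OF inj])
      next
        case False
        then show ?thesis using T extensional_arb[OF ssytD(1), of T la c] extensional_arb[OF ssytD(1), of U la c] by auto
      qed
    qed
    show "?f ` {T \<in> ssyt la. Defs.content la T = x} \<subseteq> {T \<in> ssyt la. Defs.content la T = y}"
    proof (rule image_subsetI)
      fix T assume "T \<in> {T \<in> ssyt la. Defs.content la T = x}"
      then have T: "T \<in> ssyt la" "Defs.content la T = x" by auto
      have lt: "\<phi> (T c) < \<phi> (T d)" if "c \<in> cells la" "d \<in> cells la" "T c < T d" for c d
        using strict_mono_onD[OF mono K[OF T(2) that(1)] K[OF T(2) that(2)] that(3)] .
      then have le: "\<phi> (T c) \<le> \<phi> (T d)" if "c \<in> cells la" "d \<in> cells la" "T c \<le> T d" for c d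
        using that by (cases "T c = T d") (auto simp: less_imp_le)
      have "?f T \<in> ssyt la"
        unfolding ssyt_def
      proof (intro CollectI conjI allI impI)
        fix i j j' assume *: "(i, j) \<in> cells la \<and> (i, j') \<in> cells la \<and> j < j'"
        then have "T (i, j) \<le> T (i, j')" using ssytD(2)[OF T(1)] by blast
        then show "?f T (i, j) \<le> ?f T (i, j')" using * le by simp
      next
        fix i i' j assume *: "(i, j) \<in> cells la \<and> (i', j) \<in> cells la \<and> i < i'"
        then have "T (i, j) < T (i', j)" using ssytD(3)[OF T(1)] by blast
        then show "?f T (i, j) < ?f T (i', j)" using * lt by simp
      qed auto
      moreover have "Defs.content la (?f T) = y"
      proof (rule poly_mapping_eqI)
        fix w
        have set: "{c \<in> cells la. ?f T c = w} = {c \<in> cells la. \<phi> (T c) = w}" by auto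
        show "Poly_Mapping.lookup (Defs.content la (?f T)) w = Poly_Mapping.lookup y w"
        proof (cases "w \<in> Poly_Mapping.keys y")
          case True
          then obtain v where v: "v \<in> Poly_Mapping.keys x" "w = \<phi> v"
            using bij by (auto simp: bij_betw_def)
          have "{c \<in> cells la. \<phi> (T c) = w} = {c \<in> cells la. T c = v}"
            using inj_onD[OF inj _ K[OF T(2)] v(1)] v(2) by auto
          then show ?thesis
            using lk[OF v(1)] T(2) v(2) lookup_content[of la T v] unfolding lookup_content[of la "?f T"] set by simp
        next
          case False
          then have "{c \<in> cells la. \<phi> (T c) = w} = {}"
            using K[OF T(2)] bij by (auto simp: bij_betw_def)
          then show ?thesis
            using False unfolding lookup_content set by (simp add: in_keys_iff)
        qed
      qed
      ultimately show "?f T \<in> {T \<in> ssyt la. Defs.content la T = y}" by blast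
    qed
  qed
qed

lemma schur_QSym: "schur la \<in> QSym"
proof (rule QSymI[of _ "card (cells la)"])
  fix x assume "schur la x \<noteq> 0"
  then have "card {T \<in> ssyt la. Defs.content la T = x} \<noteq> 0"
    by (simp add: schur_def)
  then have "{T \<in> ssyt la. Defs.content la T = x} \<noteq> {}"
    by (metis card.empty)
  then show "mdeg x \<le> card (cells la)" by (auto simp: mdeg_content)
next
  fix x y :: monomial assume eq: "exponent_composition x = exponent_composition y"
  show "schur la x = schur la y"
    unfolding schur_def
    by (intro arg_cong[where f = of_nat] order.antisym card_ssyt_content_le eq eq[symmetric])
qed

text \<open>Pairing with a Schur function is a constant term, hence the inverted variables; the index
  \<open>m - 1 - i\<close> undoes the reading order of \<open>laurent_word\<close>.\<close>

definition yvar :: "nat \<Rightarrow> nat \<Rightarrow> laurent" where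
  "yvar m i = Poly_Mapping.single (mvar (m - 1 - i) (- 1)) 1"

text \<open>By linearity \<open>f\<close> may be a monomial with exponents \<open>g\<close>. In
  inverted variables a tableau contributes to the constant term iff its content is \<open>g\<close>,
  and the coefficient of the Schur function counts just these.\<close>

lemma pairing_laurent_word_schur:
  assumes f: "f \<in> laurent_below m"
  shows "pairing (laurent_word m f) (schur la) = Poly_Mapping.lookup (f * schur_poly m (yvar m) la) 0"
proof -
  have step: "pairing (laurent_word m (Poly_Mapping.single g c)) (schur la) =
      Poly_Mapping.lookup (Poly_Mapping.single g c * schur_poly m (yvar m) la) 0"
    if g: "\<And>j. m \<le> j \<Longrightarrow> Poly_Mapping.lookup g j = 0" for g c
  proof -
    define E where "E T = (\<Sum>d\<in>cells la. mvar (m - 1 - T d) (- 1))" for T :: "nat \<times> nat \<Rightarrow> nat"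
    have lE: "Poly_Mapping.lookup (E T) j = - int (card {d \<in> cells la. m - 1 - T d = j})" for T j
    proof -
      have "Poly_Mapping.lookup (E T) j = (\<Sum>d\<in>cells la. if m - 1 - T d = j then - 1 else 0)"
        unfolding E_def lookup_sum by (intro sum.cong) (auto simp: lookup_single when_def)
      then show ?thesis by (simp add: sum.If_cases Collect_conj_eq)
    qed
    have "Poly_Mapping.single g c * schur_poly m (yvar m) la =
        (\<Sum>T\<in>ssyt_below m la. Poly_Mapping.single (g + E T) c)"
      by (simp add: schur_poly_def yvar_def prod_single sum_distrib_left mult_single E_def)
    then have "Poly_Mapping.lookup (Poly_Mapping.single g c * schur_poly m (yvar m) la) 0 =
        (\<Sum>T\<in>ssyt_below m la. if g + E T = 0 then c else 0)"
      by (simp add: lookup_sum lookup_single when_def)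
    also have "\<dots> = c * of_nat (card {T \<in> ssyt_below m la. g + E T = 0})"
      by (simp add: sum.If_cases Collect_conj_eq)
    also have "of_nat (card {T \<in> ssyt_below m la. g + E T = 0}) =
        pairing (Hprod (map (Poly_Mapping.lookup g) (rev [0..<m]))) (schur la)"
    \<comment> \<open>A negative exponent cannot be cancelled by inverted variables; on the other
      side the word vanishes.\<close>
    proof (cases "\<exists>j<m. Poly_Mapping.lookup g j < 0")
      case True
      then obtain j where "Poly_Mapping.lookup g j < 0" by blast
      then have "Poly_Mapping.lookup (g + E T) j < 0" for T
        by (simp add: lookup_add lE)
      then have "{T \<in> ssyt_below m la. g + E T = 0} = {}"
        by (metis (mono_tags, lifting) empty_Collect_eq less_irrefl lookup_zero)
      then have "card {T \<in> ssyt_below m la. g + E T = 0} = 0" by (metis card.empty)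
      with True show ?thesis
        unfolding pairing_Hprod[OF schur_QSym] by simp
    next
      case False
      have "{T \<in> ssyt_below m la. g + E T = 0} =
          {T \<in> ssyt la. Defs.content la T = exponents m (\<lambda>a. nat (Poly_Mapping.lookup g (m - 1 - a)))}"
        (is "?L = ?R")
      proof (intro equalityI subsetI)
        fix T assume T: "T \<in> ?L"
        then have bd: "\<And>c. c \<in> cells la \<Longrightarrow> T c < m" and T': "T \<in> ssyt la"
          by (auto simp: ssyt_below_def)
        have "Poly_Mapping.lookup (Defs.content la T) v =
            Poly_Mapping.lookup (exponents m (\<lambda>a. nat (Poly_Mapping.lookup g (m - 1 - a)))) v" for v
        proof (cases "v < m")
          case True
          have "Poly_Mapping.lookup (g + E T) (m - 1 - v) = 0" using T by simp
          \<comment> \<open>The reflection is injective here because all entries are below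
            \<open>m\<close>, so the natural subtraction is exact.\<close>
          moreover have "{d \<in> cells la. m - 1 - T d = m - 1 - v} = {d \<in> cells la. T d = v}"
            using bd True by fastforce
          ultimately show ?thesis using True by (simp add: lookup_add lE lookup_content lookup_exponents)
        next
          case False
          then have "{d \<in> cells la. T d = v} = {}" using bd by auto
          then show ?thesis using False unfolding lookup_content lookup_exponents by simp
        qed
        then show "T \<in> ?R" using T' by (auto intro: poly_mapping_eqI)
      next
        fix T assume T: "T \<in> ?R"
        have bd: "T c < m" if "c \<in> cells la" for c
          using entry_in_keys_content[OF that, of T] T by (auto simp: in_keys_iff lookup_exponents split: if_splits)
        have "Poly_Mapping.lookup (g + E T) j = 0" for j
        proof (cases "j < m")
          case True
          have "{d \<in> cells la. m - 1 - T d = j} = {d \<in> cells la. T d = m - 1 - j}"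
            using bd True by fastforce
          moreover have "card {d \<in> cells la. T d = m - 1 - j} = nat (Poly_Mapping.lookup g j)"
            using T True by (simp add: lookup_exponents flip: lookup_content)
          moreover have "0 \<le> Poly_Mapping.lookup g j" using False True by (meson not_less)
          ultimately show ?thesis by (simp add: lookup_add lE)
        next
          case j: False
          have "{d \<in> cells la. m - 1 - T d = j} = {}"
            using bd j by fastforce
          then show ?thesis using g[of j] j unfolding lookup_add lE by simp
        qed
        then have "g + E T = 0" by (intro poly_mapping_eqI) simp
        then show "T \<in> ?L" using T bd by (simp add: ssyt_below_def)
      qed
      then show ?thesis
        unfolding pairing_Hprod[OF schur_QSym] if_not_P[OF False] by (simp add: schur_def)
    qed
    finally show ?thesis by (simp add: laurent_word_single pairing_const)
  qed
  have "pairing (laurent_word m f) (schur la) =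
      (\<Sum>g\<in>Poly_Mapping.keys f. pairing (laurent_word m (Poly_Mapping.single g (Poly_Mapping.lookup f g))) (schur la))"
    by (subst poly_mapping_expand[of f]) (simp add: laurent_word_sum pairing_sum)
  also have "\<dots> = (\<Sum>g\<in>Poly_Mapping.keys f. Poly_Mapping.lookup
      (Poly_Mapping.single g (Poly_Mapping.lookup f g) * schur_poly m (yvar m) la) 0)"
    using f by (intro sum.cong refl step) (auto simp: laurent_below_def)
  also have "\<dots> = Poly_Mapping.lookup ((\<Sum>g\<in>Poly_Mapping.keys f.
      Poly_Mapping.single g (Poly_Mapping.lookup f g)) * schur_poly m (yvar m) la) 0"
    by (simp add: sum_distrib_right lookup_sum)
  finally show ?thesis
    by (simp flip: poly_mapping_expand)
qed

section \<open>Pairing immaculate functions with Schur functions through alternants\<close>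

lemma yvar_power: "yvar m i ^ n = Poly_Mapping.single (mvar (m - 1 - i) (- int n)) 1"
proof (induction n)
  case (Suc n)
  have "mvar (m - 1 - i) (- 1) + mvar (m - 1 - i) (- int n) = mvar (m - 1 - i) (- int (Suc n))"
    by (simp flip: single_add)
  then show ?case
    using Suc by (simp add: yvar_def mult_single)
qed simp

text \<open>Reflection reverses the order and so permutes the pairs \<open>i < j\<close>.\<close>

lemma prod_pairs_reflect:
  "(\<Prod>j<m. \<Prod>i<j. F (m - 1 - j) (m - 1 - i)) = (\<Prod>j<m. \<Prod>i<j. F i j)" for m :: nat
proof -
  have "(\<Prod>j<m. \<Prod>i<j. F (m - 1 - j) (m - 1 - i)) =
      (\<Prod>(j, i)\<in>Sigma {..<m} (\<lambda>j. {..<j}). F (m - 1 - j) (m - 1 - i))"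
    by (simp add: prod.Sigma)
  also have "\<dots> = (\<Prod>(j, i)\<in>Sigma {..<m} (\<lambda>j. {..<j}). F i j)"
    by (rule prod.reindex_bij_witness[where i = "\<lambda>(j, i). (m - 1 - i, m - 1 - j)" and
        j = "\<lambda>(j, i). (m - 1 - i, m - 1 - j)"]) auto
  also have "\<dots> = (\<Prod>j<m. \<Prod>i<j. F i j)"
    by (simp add: prod.Sigma)
  finally show ?thesis .
qed

text \<open>Each factor is \<open>1 - x_j / x_i = x_j (1 / x_j - 1 / x_i)\<close>. The variable
  \<open>x_j\<close> is extracted once for every \<open>i < j\<close>, which adds \<open>j\<close>
  to its exponent.\<close>

lemma immaculate_gf_vandermonde:
  assumes "length bs = m"
  shows "immaculate_gf bs =
    Poly_Mapping.single (\<Sum>j<m. mvar j (int (bs ! (m - 1 - j)) + int j)) 1 * vandermonde m (yvar m)"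
proof -
  have "(\<Prod>j<m. \<Prod>i<j. 1 - Poly_Mapping.single (mvar j 1 - mvar i 1) 1 :: laurent) =
      (\<Prod>j<m. \<Prod>i<j. Poly_Mapping.single (mvar j 1) 1 * (yvar m (m - 1 - j) - yvar m (m - 1 - i)))"
  proof (intro prod.cong refl)
    fix i j assume "j \<in> {..<m}" "i \<in> {..<j}"
    then have "m - 1 - (m - 1 - j) = j" "m - 1 - (m - 1 - i) = i" by auto
    moreover have "mvar j 1 + mvar j (- 1) = 0" "mvar j 1 + mvar i (- 1) = mvar j 1 - mvar i 1"
      by (simp_all add: single_uminus flip: single_add)
    ultimately show "1 - Poly_Mapping.single (mvar j 1 - mvar i 1) 1 =
        (Poly_Mapping.single (mvar j 1) 1 * (yvar m (m - 1 - j) - yvar m (m - 1 - i)) :: laurent)"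
      by (simp only: yvar_def right_diff_distrib mult_single mult_1 single_one)
  qed
  also have "\<dots> = (\<Prod>j<m. Poly_Mapping.single (mvar j (int j)) 1) * vandermonde m (yvar m)"
  proof -
    have "(\<Prod>i<j. Poly_Mapping.single (mvar j 1) 1 :: laurent) = Poly_Mapping.single (mvar j (int j)) 1" for j
    proof -
      have "(\<Sum>i<n. mvar j 1) = mvar j (int n)" for n
        by (induction n) (simp_all add: add.commute del: sum_constant flip: single_add)
      then show ?thesis by (simp add: prod_single del: sum_constant prod_constant)
    qed
    moreover have "(\<Prod>j<m. \<Prod>i<j. yvar m (m - 1 - j) - yvar m (m - 1 - i)) = vandermonde m (yvar m)"
      unfolding vandermonde_def by (rule prod_pairs_reflect)
    ultimately show ?thesis by (simp only: prod.distrib)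
  qed
  finally show ?thesis
    unfolding immaculate_gf_def assms
    by (simp add: prod_single mult_single single_add sum.distrib flip: mult.assoc)
qed

text \<open>The pairing is the constant term of a monomial times an alternant in inverted variables;
  each permutation contributes its sign exactly when its exponents cancel those of the
  monomial.\<close>

lemma pairing_immaculate_schur_length:
  assumes len: "length la = length (parts \<beta>)" and dec: "sorted_wrt (\<ge>) la"
  shows "pairing (immaculate \<beta>) (schur la) = (\<Sum>p | p permutes {0..<length la}. of_int (sign p) *
    (if \<forall>i<length la. int (parts \<beta> ! i) + int (p i) = int (la ! p i) + int i then 1 else 0))"
proof -
  define m where "m = length la"
  define bs where "bs = parts \<beta>"
  have lbs: "length bs = m" by (simp add: bs_def m_def len)
  define a where "a = (\<Sum>j<m. mvar j (int (bs ! (m - 1 - j)) + int j))"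
  \<comment> \<open>The exponent vector of the alternant term of \<open>p\<close>; the constant-term
    condition is \<open>a + c p = 0\<close>.\<close>
  define c where "c p = (\<Sum>i<m. mvar (m - 1 - i) (- int (la ! p i + (m - 1 - p i))))" for p
  have "pairing (immaculate \<beta>) (schur la) =
      Poly_Mapping.lookup (immaculate_gf bs * schur_poly m (yvar m) la) 0"
    using pairing_laurent_word_schur[of "immaculate_gf bs" m] immaculate_gf_below[of bs]
    by (simp add: immaculate_def foldr_B_eq_laurent_word lbs flip: bs_def)
  also have "immaculate_gf bs * schur_poly m (yvar m) la =
      Poly_Mapping.single a 1 * alternant m (yvar m) (\<lambda>j. la ! j + (m - 1 - j))"
    using bialternant[OF m_def[symmetric] dec, of "yvar m"]
    by (simp only: immaculate_gf_vandermonde[OF lbs] a_def mult.assoc)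
  also have "\<dots> = (\<Sum>p | p permutes {0..<m}. Poly_Mapping.single (a + c p) (of_int (sign p)))"
    unfolding alternant_expand sum_distrib_left yvar_power prod_single c_def
    by (intro sum.cong refl) (simp add: mult_single flip: single_of_int)
  also have "Poly_Mapping.lookup \<dots> 0 = (\<Sum>p | p permutes {0..<m}. of_int (sign p) *
      (if \<forall>i<m. int (bs ! i) + int (p i) = int (la ! p i) + int i then 1 else 0))"
    unfolding lookup_sum
  proof (intro sum.cong refl)
    fix p assume "p \<in> {p. p permutes {0..<m}}"
    then have p: "p i < m" if "i < m" for i
      using that permutes_below by blast
    have la: "Poly_Mapping.lookup a v = (if v < m then int (bs ! (m - 1 - v)) + int v else 0)" for v
    proof -
      have "Poly_Mapping.lookup a v = (\<Sum>j<m. if j = v then int (bs ! (m - 1 - j)) + int j else 0)"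
        unfolding a_def lookup_sum by (intro sum.cong) (auto simp: lookup_single when_def)
      then show ?thesis by simp
    qed
    have lc: "Poly_Mapping.lookup (c p) v =
        (if v < m then - int (la ! p (m - 1 - v) + (m - 1 - p (m - 1 - v))) else 0)" for v
    proof (cases "v < m")
      case True
      have "Poly_Mapping.lookup (c p) v =
          (\<Sum>i<m. if i = m - 1 - v then - int (la ! p i + (m - 1 - p i)) else 0)"
        unfolding c_def lookup_sum using True by (intro sum.cong) (auto simp: lookup_single when_def)
      then show ?thesis using True by simp
    next
      case False
      then show ?thesis
        unfolding c_def lookup_sum by (auto simp: lookup_single when_def intro!: sum.neutral)
    qed
    have "a + c p = 0 \<longleftrightarrow> (\<forall>v<m. int (bs ! (m - 1 - v)) + int v =
        int (la ! p (m - 1 - v)) + int (m - 1 - p (m - 1 - v)))"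
      by (auto simp: poly_mapping_eq_iff fun_eq_iff lookup_add la lc)
    also have "\<dots> \<longleftrightarrow> (\<forall>i<m. int (bs ! i) + int (m - 1 - i) = int (la ! p i) + int (m - 1 - p i))"
    proof (intro iffI allI impI)
      fix i assume *: "\<forall>v<m. int (bs ! (m - 1 - v)) + int v =
        int (la ! p (m - 1 - v)) + int (m - 1 - p (m - 1 - v))" and i: "i < m"
      then have "m - 1 - (m - 1 - i) = i" "m - 1 - i < m" by auto
      with *[rule_format, of "m - 1 - i"]
      show "int (bs ! i) + int (m - 1 - i) = int (la ! p i) + int (m - 1 - p i)" by simp
    next
      fix v assume *: "\<forall>i<m. int (bs ! i) + int (m - 1 - i) = int (la ! p i) + int (m - 1 - p i)"
        and v: "v < m"
      then have "m - 1 - (m - 1 - v) = v" "m - 1 - v < m" by auto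
      with *[rule_format, of "m - 1 - v"]
      show "int (bs ! (m - 1 - v)) + int v =
        int (la ! p (m - 1 - v)) + int (m - 1 - p (m - 1 - v))" by simp
    qed
    \<comment> \<open>The constant \<open>m - 1\<close> of the two staircases cancels.\<close>
    also have "\<dots> \<longleftrightarrow> (\<forall>i<m. int (bs ! i) + int (p i) = int (la ! p i) + int i)"
    proof (intro all_cong1 imp_cong refl)
      fix i assume "i < m"
      then have "int (m - 1 - i) = int m - 1 - int i" "int (m - 1 - p i) = int m - 1 - int (p i)"
        using p[of i] by auto
      then show "(int (bs ! i) + int (m - 1 - i) = int (la ! p i) + int (m - 1 - p i)) =
          (int (bs ! i) + int (p i) = int (la ! p i) + int i)" by linarith
    qed
    finally have eq: "a + c p = 0 \<longleftrightarrow> (\<forall>i<m. int (bs ! i) + int (p i) = int (la ! p i) + int i)" .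
    show "Poly_Mapping.lookup (Poly_Mapping.single (a + c p) (of_int (sign p))) 0 = of_int (sign p) *
        (if \<forall>i<m. int (bs ! i) + int (p i) = int (la ! p i) + int i then 1 else 0)"
      unfolding eq[symmetric] by (simp add: lookup_single when_def)
  qed
  finally show ?thesis by (simp add: m_def bs_def)
qed

text \<open>Allows a partition to be padded with empty rows.\<close>

lemma cells_cong_schur: "cells la = cells la' \<Longrightarrow> schur la = schur la'"
  by (simp add: schur_def ssyt_def Defs.content_def)

text \<open>If \<open>\<beta>\<close> is shorter than \<open>la\<close>, a column with more rows
  than available entries leaves no tableau. If it is longer, \<open>la\<close> is padded with zeros
  and no permutation satisfies the condition.\<close>

lemma pairing_immaculate_schur:
  assumes part: "is_partition la"
  shows "pairing (immaculate \<beta>) (schur la) = (if length (parts \<beta>) = length la then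
    (\<Sum>p | p permutes {0..<length la}. of_int (sign p) *
      (if \<forall>i<length la. int (parts \<beta> ! i) + int (p i) = int (la ! p i) + int i then 1 else 0)) else 0)"
proof -
  define k where "k = length la"
  define m where "m = length (parts \<beta>)"
  have dec: "sorted_wrt (\<ge>) la" and pos: "\<And>i. i < k \<Longrightarrow> 0 < la ! i"
    using part by (auto simp: is_partition_def k_def)
  consider "m = k" | "m < k" | "k < m" by linarith
  then show ?thesis
  proof cases
    case 1
    then show ?thesis
      using pairing_immaculate_schur_length[of la \<beta>] dec by (simp add: m_def k_def)
  next
    case 2
    have "T (k - 1, 0) \<ge> k - 1" if "T \<in> ssyt la" for T
      using 2 pos[of "k - 1"] by (intro ssyt_entry_ge_row[OF that dec]) (auto simp: cells_def k_def)
    moreover have "(k - 1, 0) \<in> cells la"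
      using 2 pos[of "k - 1"] by (auto simp: cells_def k_def)
    ultimately have "ssyt_below m la = {}"
      using 2 by (fastforce simp: ssyt_below_def)
    then have "schur_poly m (yvar m) la = 0" by (simp add: schur_poly_def)
    then have "pairing (immaculate \<beta>) (schur la) = 0"
      using pairing_laurent_word_schur[OF immaculate_gf_below, of "parts \<beta>" la]
      by (simp add: immaculate_def foldr_B_eq_laurent_word flip: m_def)
    then show ?thesis using 2 by (simp add: m_def k_def)
  next
    case 3
    define la' where "la' = la @ replicate (m - k) 0"
    have "cells la = cells la'"
      using pos by (auto simp: cells_def la'_def nth_append k_def split: if_splits)
    then have eq: "schur la = schur la'" by (rule cells_cong_schur)
    have "sorted_wrt (\<ge>) (replicate n (0 :: nat))" for n
      by (induction n) auto
    then have dec': "sorted_wrt (\<ge>) la'" and len: "length la' = m"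
      using dec 3 by (auto simp: la'_def sorted_wrt_append k_def)
    have no: "\<not> (\<forall>i<m. int (parts \<beta> ! i) + int (p i) = int (la' ! p i) + int i)" if p: "p permutes {0..<m}" for p
    proof
      assume *: "\<forall>i<m. int (parts \<beta> ! i) + int (p i) = int (la' ! p i) + int i"
      \<comment> \<open>The position sent to the last, empty row would need the part
        \<open>i - (m - 1) \<le> 0\<close>.\<close>
      have "m - 1 \<in> p ` {0..<m}"
        unfolding permutes_image[OF p] using 3 by auto
      then obtain i where i: "i < m" "p i = m - 1" by auto
      have "la' ! (m - 1) = 0"
        using 3 by (auto simp: la'_def nth_append k_def)
      moreover have "0 < parts \<beta> ! i"
        using i by (intro parts_pos[of _ \<beta>]) (simp add: m_def)
      moreover have "int (parts \<beta> ! i) + int (m - 1) = int (la' ! (m - 1)) + int i"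
        using *[rule_format, OF i(1)] i(2) by simp
      ultimately show False using i(1) 3 by linarith
    qed
    have "pairing (immaculate \<beta>) (schur la) = (\<Sum>p | p permutes {0..<m}. of_int (sign p) *
        (if \<forall>i<m. int (parts \<beta> ! i) + int (p i) = int (la' ! p i) + int i then 1 else 0))"
      using pairing_immaculate_schur_length[of la' \<beta>] dec' len unfolding eq by (simp add: m_def)
    also have "\<dots> = 0"
    proof (rule sum.neutral, rule ballI)
      fix p assume "p \<in> {p. p permutes {0..<m}}"
      then have "p permutes {0..<m}" by simp
      then show "of_int (sign p) *
        (if \<forall>i<m. int (parts \<beta> ! i) + int (p i) = int (la' ! p i) + int i then 1 else 0) = (0 :: rat)"
        unfolding if_not_P[OF no[OF \<open>p permutes {0..<m}\<close>]] by simp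
    qed
    finally have "pairing (immaculate \<beta>) (schur la) = 0" .
    then show ?thesis using 3 by (simp add: m_def k_def)
  qed
qed

section \<open>The signed expansion over permutations\<close>

lemma pairing_lincomb: "pairing h (\<lambda>x. \<Sum>i\<in>I. c i * F i x) = (\<Sum>i\<in>I. c i * pairing h (F i))"
  unfolding pairing_def M_coeff_def sum_distrib_left
  by (subst sum.swap) (simp add: mult_ac)


text \<open>Conjugation preserves the sign. The successor map is completed to a cycle, since it has
  to be a permutation of a finite set to be conjugated with.\<close>

lemma sum_sign_permutes_shift:
  "(\<Sum>p | p permutes {0..<k}. of_int (sign p) * (if \<forall>i<k. P i (p i) then 1 else 0)) =
    (\<Sum>\<sigma> | \<sigma> permutes {1..k}. of_int (sign \<sigma>) * (if \<forall>i\<in>{1..k}. P (i - 1) (\<sigma> i - 1) then 1 else (0 :: rat)))" for k :: nat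
proof -
  \<comment> \<open>\<open>c\<close> is the cycle \<open>0 \<mapsto> 1 \<mapsto> \<cdots> \<mapsto> k \<mapsto> 0\<close> and \<open>d\<close> its inverse.\<close>
  define c where "c i = (if i < k then Suc i else if i = k then 0 else i)" for i :: nat
  define d where "d i = (if i = 0 then k else if i \<le> k then i - 1 else i)" for i :: nat
  have cd: "c (d i) = i" and dc: "d (c i) = i" for i
    by (auto simp: c_def d_def)
  have "bij c" "bij d"
    by (auto intro!: o_bij[of d c] o_bij[of c d] simp: cd dc fun_eq_iff)
  have perm: "c permutes {..k}" "d permutes {..k}"
    unfolding permutes_def using \<open>bij c\<close> \<open>bij d\<close> by (auto simp: bij_iff c_def d_def)
  have sgn: "sign (d \<circ> q \<circ> c) = sign q" if "permutation q" for q
  proof -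
    have "permutation c" "permutation d"
      using perm permutation_permutes by blast+
    moreover from this have "sign d * sign c = 1"
      by (metis comp_apply dc eq_id_iff ext sign_compose sign_id)
    ultimately show ?thesis
      using that by (simp add: sign_compose permutation_compose mult_ac)
  qed
  have conj1: "d \<circ> \<sigma> \<circ> c permutes {0..<k}" if "\<sigma> permutes {1..k}" for \<sigma>
  proof -
    have "bij (d \<circ> \<sigma> \<circ> c)"
      using \<open>bij c\<close> \<open>bij d\<close> permutes_bij[OF that] by (intro bij_comp)
    moreover have "(d \<circ> \<sigma> \<circ> c) x = x" if x: "x \<notin> {0..<k}" for x
    proof -
      have "c x \<notin> {1..k}" using x by (auto simp: c_def)
      then show ?thesis using permutes_not_in[OF \<open>\<sigma> permutes {1..k}\<close>] by (simp add: dc)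
    qed
    ultimately show ?thesis unfolding permutes_def bij_iff by blast
  qed
  have conj2: "c \<circ> p \<circ> d permutes {1..k}" if "p permutes {0..<k}" for p
  proof -
    have "bij (c \<circ> p \<circ> d)"
      using \<open>bij c\<close> \<open>bij d\<close> permutes_bij[OF that] by (intro bij_comp)
    moreover have "(c \<circ> p \<circ> d) x = x" if x: "x \<notin> {1..k}" for x
    proof -
      have "d x \<notin> {0..<k}" using x by (auto simp: d_def)
      then show ?thesis using permutes_not_in[OF \<open>p permutes {0..<k}\<close>] by (simp add: cd)
    qed
    ultimately show ?thesis unfolding permutes_def bij_iff by blast
  qed
  show ?thesis
  proof (rule sum.reindex_bij_witness[symmetric, where j = "\<lambda>\<sigma>. d \<circ> \<sigma> \<circ> c" and i = "\<lambda>p. c \<circ> p \<circ> d"])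
    fix \<sigma> assume "\<sigma> \<in> {\<sigma>. \<sigma> permutes {1..k}}"
    then have \<sigma>: "\<sigma> permutes {1..k}" by simp
    have "(d \<circ> \<sigma> \<circ> c) (i - 1) = \<sigma> i - 1" if "i \<in> {1..k}" for i
    proof -
      have "\<sigma> i \<in> {1..k}" "c (i - 1) = i"
        using permutes_in_image[OF \<sigma>, of i] that by (auto simp: c_def)
      then show ?thesis by (auto simp: d_def)
    qed
    then have "(\<forall>i\<in>{1..k}. P (i - 1) (\<sigma> i - 1)) \<longleftrightarrow> (\<forall>i\<in>{1..k}. P (i - 1) ((d \<circ> \<sigma> \<circ> c) (i - 1)))"
      by simp
    also have "\<dots> \<longleftrightarrow> (\<forall>i<k. P i ((d \<circ> \<sigma> \<circ> c) i))"
    proof (intro iffI allI impI ballI)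
      fix i assume *: "\<forall>i\<in>{1..k}. P (i - 1) ((d \<circ> \<sigma> \<circ> c) (i - 1))" and "i < k"
      then show "P i ((d \<circ> \<sigma> \<circ> c) i)" using bspec[OF *, of "Suc i"] by simp
    qed auto
    moreover have "permutation \<sigma>"
      using \<sigma> permutation_permutes by blast
    ultimately show "of_int (sign (d \<circ> \<sigma> \<circ> c)) * (if \<forall>i<k. P i ((d \<circ> \<sigma> \<circ> c) i) then 1 else 0) =
        of_int (sign \<sigma>) * (if \<forall>i\<in>{1..k}. P (i - 1) (\<sigma> i - 1) then 1 else (0 :: rat))"
      by (simp only: sgn)
  qed (use conj1 conj2 in \<open>auto simp: cd dc fun_eq_iff\<close>)
qed

theorem theorem3p38:
  fixes la :: "nat list" and k :: nat
  assumes "is_partition la" and "length la = k"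
  shows "schur la =
    (\<lambda>x. \<Sum>\<sigma> | \<sigma> permutes {1..k} \<and>
                (\<forall>i\<in>{1..k}. int (la ! (\<sigma> i - 1)) + int i - int (\<sigma> i) > 0).
       of_int (sign \<sigma>) *
       dual_immaculate
         (Composition (map (\<lambda>i. nat (int (la ! (\<sigma> i - 1)) + int i - int (\<sigma> i))) [1..<k + 1])) x)"
proof -
  define e where "e \<sigma> i = int (la ! (\<sigma> i - 1)) + int i - int (\<sigma> i)" for \<sigma> :: "nat \<Rightarrow> nat" and i
  define V where "V = {\<sigma>. \<sigma> permutes {1..k} \<and> (\<forall>i\<in>{1..k}. e \<sigma> i > 0)}"
  define \<alpha> where "\<alpha> \<sigma> = Composition (map (\<lambda>i. nat (e \<sigma> i)) [1..<k + 1])" for \<sigma>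
  have fin: "finite {\<sigma>. \<sigma> permutes {1..k}}" by (rule finite_permutations) simp
  then have finV: "finite V" by (rule rev_finite_subset) (auto simp: V_def)
  have parts_\<alpha>: "parts (\<alpha> \<sigma>) = map (\<lambda>i. nat (e \<sigma> i)) [1..<k + 1]" if "\<sigma> \<in> V" for \<sigma>
    unfolding \<alpha>_def using that by (intro parts_Composition) (auto simp: V_def)
  \<comment> \<open>On \<open>V\<close> all \<open>e \<sigma> i\<close> are positive, so
    \<open>nat\<close> loses nothing and no part is zero.\<close>
  have \<alpha>_eq: "\<alpha> \<sigma> = \<beta> \<longleftrightarrow> length (parts \<beta>) = k \<and> (\<forall>i\<in>{1..k}. int (parts \<beta> ! (i - 1)) = e \<sigma> i)"
    if \<sigma>: "\<sigma> \<in> V" for \<sigma> \<beta>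
  proof -
    have "\<alpha> \<sigma> = \<beta> \<longleftrightarrow> map (\<lambda>i. nat (e \<sigma> i)) [1..<k + 1] = parts \<beta>"
      using parts_\<alpha>[OF \<sigma>] by (metis parts_inject)
    also have "\<dots> \<longleftrightarrow> length (parts \<beta>) = k \<and> (\<forall>j<k. nat (e \<sigma> (Suc j)) = parts \<beta> ! j)"
      by (auto simp: list_eq_iff_nth_eq simp del: upt_Suc)
    also have "(\<forall>j<k. nat (e \<sigma> (Suc j)) = parts \<beta> ! j) \<longleftrightarrow> (\<forall>i\<in>{1..k}. nat (e \<sigma> i) = parts \<beta> ! (i - 1))"
    proof (intro iffI allI impI ballI)
      fix i assume *: "\<forall>j<k. nat (e \<sigma> (Suc j)) = parts \<beta> ! j" and "i \<in> {1..k}"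
      then show "nat (e \<sigma> i) = parts \<beta> ! (i - 1)" using *[rule_format, of "i - 1"] by auto
    next
      fix j assume *: "\<forall>i\<in>{1..k}. nat (e \<sigma> i) = parts \<beta> ! (i - 1)" and "j < k"
      then show "nat (e \<sigma> (Suc j)) = parts \<beta> ! j" using bspec[OF *, of "Suc j"] by simp
    qed
    also have "\<dots> \<longleftrightarrow> (\<forall>i\<in>{1..k}. int (parts \<beta> ! (i - 1)) = e \<sigma> i)"
    proof (intro ball_cong refl)
      fix i assume "i \<in> {1..k}"
      then have "0 < e \<sigma> i" using \<sigma> by (simp add: V_def)
      then show "(nat (e \<sigma> i) = parts \<beta> ! (i - 1)) = (int (parts \<beta> ! (i - 1)) = e \<sigma> i)"
        by (auto simp: nat_eq_iff)
    qed
    finally show ?thesis .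
  qed
  define G where "G = (\<lambda>x. \<Sum>\<sigma>\<in>V. of_int (sign \<sigma>) * dual_immaculate (\<alpha> \<sigma>) x)"
  have "schur la = G"
  \<comment> \<open>Both sides are compared by their pairings with the immaculate functions.\<close>
  proof (rule QSym_eqI_immaculate[OF schur_QSym])
    show "G \<in> QSym"
      unfolding G_def by (intro QSym_lincomb finV dual_immaculate_QSym)
    fix \<beta>
    have G: "pairing (immaculate \<beta>) G = (\<Sum>\<sigma>\<in>V. of_int (sign \<sigma>) * (if \<alpha> \<sigma> = \<beta> then 1 else 0))"
      unfolding G_def pairing_lincomb pairing_dual_immaculate ..
    show "pairing (immaculate \<beta>) (schur la) = pairing (immaculate \<beta>) G"
    proof (cases "length (parts \<beta>) = k")
      case True
      \<comment> \<open>The matching condition in zero-based indices; the subtractions are exact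
        because \<open>i\<close> and \<open>\<sigma> i\<close> are at least 1.\<close>
      define Q where "Q \<sigma> \<longleftrightarrow> (\<forall>i\<in>{1..k}. int (parts \<beta> ! (i - 1)) + int (\<sigma> i - 1) =
          int (la ! (\<sigma> i - 1)) + int (i - 1))" for \<sigma> :: "nat \<Rightarrow> nat"
      have Q: "Q \<sigma> \<longleftrightarrow> (\<forall>i\<in>{1..k}. int (parts \<beta> ! (i - 1)) = e \<sigma> i)" if "\<sigma> permutes {1..k}" for \<sigma>
        unfolding Q_def
      proof (intro ball_cong refl)
        fix i assume i: "i \<in> {1..k}"
        then have "1 \<le> \<sigma> i" using permutes_in_image[OF that, of i] by simp
        then show "(int (parts \<beta> ! (i - 1)) + int (\<sigma> i - 1) = int (la ! (\<sigma> i - 1)) + int (i - 1)) =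
            (int (parts \<beta> ! (i - 1)) = e \<sigma> i)"
          using i by (auto simp: e_def)
      qed
      \<comment> \<open>A matching permutation has the parts of \<open>\<beta>\<close> as its
        values, which are positive. So the permutations outside \<open>V\<close> contribute nothing
        and the sum shrinks to \<open>V\<close>.\<close>
      have QV: "\<sigma> \<in> V" if "\<sigma> permutes {1..k}" "Q \<sigma>" for \<sigma>
      proof -
        have "0 < e \<sigma> i" if i: "i \<in> {1..k}" for i
        proof -
          have "0 < parts \<beta> ! (i - 1)" using i True by (intro parts_pos[of _ \<beta>]) auto
          then show ?thesis using Q[OF \<open>\<sigma> permutes {1..k}\<close>] \<open>Q \<sigma>\<close> i by force
        qed
        then show ?thesis using that by (simp add: V_def)
      qed
      have "pairing (immaculate \<beta>) (schur la) = (\<Sum>\<sigma> | \<sigma> permutes {1..k}. of_int (sign \<sigma>) * (if Q \<sigma> then 1 else 0))"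
        unfolding pairing_immaculate_schur[OF assms(1)] assms(2) Q_def if_P[OF True]
        by (rule sum_sign_permutes_shift)
      also have "\<dots> = (\<Sum>\<sigma>\<in>V. of_int (sign \<sigma>) * (if Q \<sigma> then 1 else 0))"
        by (rule sum.mono_neutral_right[OF fin]) (use QV in \<open>auto simp: V_def\<close>)
      also have "\<dots> = pairing (immaculate \<beta>) G"
        unfolding G using Q True by (intro sum.cong refl) (auto simp: \<alpha>_eq V_def)
      finally show ?thesis .
    next
      case False
      then show ?thesis
        unfolding G pairing_immaculate_schur[OF assms(1)] assms(2)
        by (simp add: \<alpha>_eq)
    qed
  qed
  then show ?thesis
    by (simp only: G_def V_def \<alpha>_def e_def)
qed

end
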